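(* Let $G$ be a torus acting linearly on $M=\mathbb R^m$, and let $\Psi$ be an abstract moment map on a ($G$-invariant open) neighborhood of the origin, vanishing at the origin. Then there exists a $G$-invariant one-form $\mu$ on a neighborhood of the origin such that $\mu(\xi_M)=\Psi^\xi$ for all $\xi\in\mathfrak g$.
   Context: $\mathfrak g$ is the Lie algebra of $G$, and $\xi_M$ is the vector field on $M=\mathbb R^m$ generated by $\xi\in\mathfrak g$. For a subgroup $H\subseteq G$ with Lie algebra $\mathfrak h$ and a $\mathfrak g^*$-valued map $\Psi$, $\Psi^H$ denotes the composition of $\Psi$ with the restriction $\mathfrak g^*\to\mathfrak h^*$, and $\Psi^\xi=\langle\Psi,\xi\rangle$. An abstract moment map on a $G$-manifold $U$ is a smooth $G$-equivariant map $\Psi\colon U\to\mathfrak g^*$ such that for every (Lie) subgroup $H\subseteq G$ the map $\Psi^H\colon U\to\mathfrak h^*$ is locally constant on the fixed point set $U^H$. *)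

theory Defs
  imports "HOL-Analysis.Analysis" "HOL-Algebra.Group_Action"
begin

section \<open>Smooth maps and locally constant maps\<close>

text \<open>
  Maps of class $C^k$ on an open subset of a normed space. For a finite-dimensional domain this is
  the usual notion: all iterated directional derivatives up to order $k$ exist and are continuous.
\<close>

primrec Ck_on :: "nat \<Rightarrow> 'a::real_normed_vector set \<Rightarrow> ('a \<Rightarrow> 'b::real_normed_vector) \<Rightarrow> bool" where
  "Ck_on 0 S f \<longleftrightarrow> continuous_on S f"
| "Ck_on (Suc k) S f \<longleftrightarrow>
     (\<forall>x\<in>S. f differentiable (at x)) \<and> (\<forall>v. Ck_on k S (\<lambda>x. frechet_derivative f (at x) v))"

definition smooth_on :: "'a::real_normed_vector set \<Rightarrow> ('a \<Rightarrow> 'b::real_normed_vector) \<Rightarrow> bool" where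
  "smooth_on S f \<longleftrightarrow> (\<forall>k. Ck_on k S f)"

definition locally_constant_on :: "('a::topological_space \<Rightarrow> 'b) \<Rightarrow> 'a set \<Rightarrow> bool" where
  "locally_constant_on f S \<longleftrightarrow>
     (\<forall>x\<in>S. \<exists>V. openin (top_of_set S) V \<and> x \<in> V \<and> f constant_on V)"


section \<open>Tori and their subgroups\<close>

text \<open>
  The torus $(S^1)^n$, with $n$ the cardinality of the index type. Multiplication and unit of
  \<^typ>\<open>complex ^ 'n\<close> are componentwise. The Lie algebra is \<^typ>\<open>real ^ 'n\<close>, and its dual is
  the space \<^typ>\<open>(real ^ 'n) \<Rightarrow>\<^sub>L real\<close> of linear functionals.
\<close>

definition torus :: "(complex ^ 'n::finite) monoid" where
  "torus = \<lparr>carrier = {z. \<forall>i. norm (z $ i) = 1}, monoid.mult = (*), one = 1\<rparr>"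

definition torus_exp :: "real ^ 'n::finite \<Rightarrow> complex ^ 'n" where
  "torus_exp \<xi> = (\<chi> i. cis (\<xi> $ i))"

text \<open>
  The Lie algebra of a subgroup. The definition makes sense for an arbitrary subgroup $H$ and gives
  the usual Lie algebra whenever $H$ is a closed, or more generally an immersed, Lie subgroup.
\<close>

definition lie_subalgebra :: "(complex ^ 'n::finite) set \<Rightarrow> (real ^ 'n) set" where
  "lie_subalgebra H = {\<xi>. \<forall>t. torus_exp (t *\<^sub>R \<xi>) \<in> H}"


section \<open>Linear torus actions and abstract moment maps\<close>

definition linear_torus_action ::
    "(complex ^ 'n::finite \<Rightarrow> real ^ 'm::finite \<Rightarrow> real ^ 'm) \<Rightarrow> bool" where
  "linear_torus_action \<phi> \<longleftrightarrow>
     group_action torus UNIV \<phi> \<and>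
     (\<forall>g\<in>carrier torus. linear (\<phi> g)) \<and>
     continuous_on (carrier torus \<times> UNIV) (\<lambda>(g, x). \<phi> g x)"

text \<open>The vector field $\xi_M(x) = \frac{d}{dt}|_{t=0} \exp(t\xi)\cdot x$.\<close>

definition generated_field ::
    "(complex ^ 'n::finite \<Rightarrow> real ^ 'm::finite \<Rightarrow> real ^ 'm) \<Rightarrow> real ^ 'n \<Rightarrow> real ^ 'm \<Rightarrow> real ^ 'm" where
  "generated_field \<phi> \<xi> x = vector_derivative (\<lambda>t. \<phi> (torus_exp (t *\<^sub>R \<xi>)) x) (at 0)"

definition invariant_set ::
    "(complex ^ 'n::finite \<Rightarrow> real ^ 'm::finite \<Rightarrow> real ^ 'm) \<Rightarrow> (real ^ 'm) set \<Rightarrow> bool" where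
  "invariant_set \<phi> U \<longleftrightarrow> (\<forall>g\<in>carrier torus. \<forall>x\<in>U. \<phi> g x \<in> U)"

definition fixed_points ::
    "(complex ^ 'n::finite \<Rightarrow> real ^ 'm::finite \<Rightarrow> real ^ 'm) \<Rightarrow>
     (complex ^ 'n) set \<Rightarrow> (real ^ 'm) set \<Rightarrow> (real ^ 'm) set" where
  "fixed_points \<phi> H U = {x\<in>U. \<forall>h\<in>H. \<phi> h x = x}"

text \<open>
  Abstract moment maps on an open invariant set $U$. The coadjoint action of a torus is trivial, so
  equivariance of $\Psi$ means invariance. The map $\Psi^H$ sends $x$ to the restriction of the
  functional $\Psi(x)$ to the Lie algebra of $H$.
\<close>

definition abstract_moment_map ::
    "(complex ^ 'n::finite \<Rightarrow> real ^ 'm::finite \<Rightarrow> real ^ 'm) \<Rightarrow> (real ^ 'm) set \<Rightarrow>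
     (real ^ 'm \<Rightarrow> (real ^ 'n) \<Rightarrow>\<^sub>L real) \<Rightarrow> bool" where
  "abstract_moment_map \<phi> U \<Psi> \<longleftrightarrow>
     smooth_on U \<Psi> \<and>
     (\<forall>g\<in>carrier torus. \<forall>x\<in>U. \<Psi> (\<phi> g x) = \<Psi> x) \<and>
     (\<forall>H. subgroup H torus \<longrightarrow>
        locally_constant_on (\<lambda>x. restrict (blinfun_apply (\<Psi> x)) (lie_subalgebra H))
          (fixed_points \<phi> H U))"

text \<open>
  One-forms on an open set $V$ are maps into the dual space. Each $\phi(g)$ is linear, hence equal to
  its own differential, so the pullback of $\mu$ under $\phi(g)$ is
  $v \mapsto \mu(\phi(g) x)(\phi(g) v)$ at the point $x$.
\<close>

definition invariant_one_form ::
    "(complex ^ 'n::finite \<Rightarrow> real ^ 'm::finite \<Rightarrow> real ^ 'm) \<Rightarrow> (real ^ 'm) set \<Rightarrow>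
     (real ^ 'm \<Rightarrow> (real ^ 'm) \<Rightarrow>\<^sub>L real) \<Rightarrow> bool" where
  "invariant_one_form \<phi> V \<mu> \<longleftrightarrow>
     smooth_on V \<mu> \<and>
     (\<forall>g\<in>carrier torus. \<forall>x\<in>V. \<forall>v. blinfun_apply (\<mu> (\<phi> g x)) (\<phi> g v) = blinfun_apply (\<mu> x) v)"


section \<open>Independence of the class of subgroups\<close>

lemma comm_group_torus: "comm_group (torus :: (complex ^ 'n::finite) monoid)"
proof (rule comm_groupI)
  fix x :: "complex ^ 'n"
  assume x: "x \<in> carrier torus"
  show "\<exists>y\<in>carrier torus. y \<otimes>\<^bsub>torus\<^esub> x = \<one>\<^bsub>torus\<^esub>"
    by (rule bexI[of _ "\<chi> i. inverse (x $ i)"])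
       (use x in \<open>auto simp: torus_def vec_eq_iff norm_inverse intro!: left_inverse,
          metis norm_zero zero_neq_one\<close>)
qed (auto simp: torus_def norm_mult mult_ac vec_eq_iff)

lemma torus_exp_closed: "torus_exp \<xi> \<in> carrier torus"
  by (simp add: torus_def torus_exp_def)

lemma torus_exp_add: "torus_exp (\<xi> + \<eta>) = torus_exp \<xi> \<otimes>\<^bsub>torus\<^esub> torus_exp \<eta>"
  by (simp add: torus_def torus_exp_def vec_eq_iff cis_mult)

lemma inv_torus:
  fixes x :: "complex ^ 'n::finite"
  assumes "x \<in> carrier torus"
  shows "inv\<^bsub>torus\<^esub> x = (\<chi> i. cnj (x $ i))"
proof -
  interpret comm_group "torus :: (complex ^ 'n) monoid" by (rule comm_group_torus)
  have "(\<chi> i. cnj (x $ i)) \<otimes>\<^bsub>torus\<^esub> x = \<one>\<^bsub>torus\<^esub>"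
    using assms by (auto simp: torus_def vec_eq_iff mult.commute[of "cnj _"] complex_norm_square[symmetric])
  moreover have "(\<chi> i. cnj (x $ i)) \<in> carrier torus"
    using assms by (auto simp: torus_def)
  ultimately show ?thesis
    using assms inv_equality by blast
qed

lemma closed_torus: "closed (carrier (torus :: (complex ^ 'n::finite) monoid))"
  unfolding torus_def by (auto intro!: closed_Collect_all closed_Collect_eq continuous_intros)

lemma subgroup_closure_torus:
  fixes H :: "(complex ^ 'n::finite) set"
  assumes "subgroup H torus"
  shows "subgroup (closure H) torus"
proof -
  interpret comm_group "torus :: (complex ^ 'n) monoid" by (rule comm_group_torus)
  interpret H: subgroup H torus by fact
  have sub: "closure H \<subseteq> carrier torus"
    by (simp add: closure_minimal closed_torus H.subset)
  have "x * y \<in> closure H" if xy: "x \<in> closure H" "y \<in> closure H" for x y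
  proof -
    from xy obtain a b where a: "\<And>n. a n \<in> H" "a \<longlonglongrightarrow> x" and b: "\<And>n. b n \<in> H" "b \<longlonglongrightarrow> y"
      by (meson closure_sequential)
    have "(\<lambda>n. a n * b n) \<longlonglongrightarrow> x * y"
      by (rule vec_tendstoI) (auto intro!: tendsto_intros a b)
    moreover have "a n * b n \<in> H" for n
      using H.m_closed[OF a(1) b(1)] by (simp add: torus_def)
    ultimately show ?thesis by (meson closure_sequential)
  qed
  moreover have "(\<chi> i. cnj (x $ i)) \<in> closure H" if x: "x \<in> closure H" for x
  proof -
    from x obtain a where a: "\<And>n. a n \<in> H" "a \<longlonglongrightarrow> x"
      by (meson closure_sequential)
    have "(\<lambda>n. \<chi> i. cnj (a n $ i)) \<longlonglongrightarrow> (\<chi> i. cnj (x $ i))"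
      by (rule vec_tendstoI) (auto intro!: tendsto_intros a)
    moreover have "(\<chi> i. cnj (a n $ i)) \<in> H" for n
      using H.m_inv_closed[OF a(1)] a(1)[of n] H.subset by (metis inv_torus subsetD)
    ultimately show ?thesis
      by (meson closure_sequential)
  qed
  moreover have "1 \<in> closure H"
    using H.one_closed closure_subset[of H] by (auto simp: torus_def)
  ultimately show ?thesis
    using sub
    by (intro subgroupI) (auto simp: inv_torus subsetD, auto simp: torus_def)
qed

lemma fixed_points_closure:
  assumes "linear_torus_action \<phi>" "subgroup H torus"
  shows "fixed_points \<phi> (closure H) U = fixed_points \<phi> H U"
proof -
  have sub: "closure H \<subseteq> carrier torus"
    using assms(2) by (simp add: closure_minimal closed_torus subgroup.subset)
  have "\<phi> h x = x" if "\<forall>h\<in>H. \<phi> h x = x" "h \<in> closure H" for h x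
  proof -
    have "continuous_on (closure H) ((\<lambda>(g, x). \<phi> g x) \<circ> (\<lambda>g. (g, x)))"
      using assms(1) sub unfolding linear_torus_action_def
      by (intro continuous_on_compose continuous_intros) (auto elim!: continuous_on_subset)
    then have "continuous_on (closure H) (\<lambda>g. \<phi> g x)"
      by (simp add: o_def)
    then show ?thesis
      using continuous_constant_on_closure[of H "\<lambda>g. \<phi> g x" x h] that by auto
  qed
  then show ?thesis
    using closure_subset[of H] by (auto simp: fixed_points_def)
qed

text \<open>
  The definition of an abstract moment map quantifies over all subgroups, in particular over all
  Lie subgroups, embedded or immersed. Requiring the condition only for closed subgroups gives
  the same notion.
\<close>

lemma abstract_moment_map_iff_closed_subgroups:
  assumes "linear_torus_action \<phi>"
  shows "abstract_moment_map \<phi> U \<Psi> \<longleftrightarrow>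
     smooth_on U \<Psi> \<and>
     (\<forall>g\<in>carrier torus. \<forall>x\<in>U. \<Psi> (\<phi> g x) = \<Psi> x) \<and>
     (\<forall>H. subgroup H torus \<and> closed H \<longrightarrow>
        locally_constant_on (\<lambda>x. restrict (blinfun_apply (\<Psi> x)) (lie_subalgebra H))
          (fixed_points \<phi> H U))"
proof -
  have "locally_constant_on (\<lambda>x. restrict (blinfun_apply (\<Psi> x)) (lie_subalgebra H))
          (fixed_points \<phi> H U)"
    if *: "\<forall>H. subgroup H torus \<and> closed H \<longrightarrow>
        locally_constant_on (\<lambda>x. restrict (blinfun_apply (\<Psi> x)) (lie_subalgebra H))
          (fixed_points \<phi> H U)" and H: "subgroup H torus" for H
  proof -
    have sub: "lie_subalgebra H \<subseteq> lie_subalgebra (closure H)"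
      using closure_subset[of H] by (auto simp: lie_subalgebra_def)
    have "locally_constant_on (\<lambda>x. restrict (blinfun_apply (\<Psi> x)) (lie_subalgebra (closure H)))
        (fixed_points \<phi> H U)"
      using *[rule_format, of "closure H"] subgroup_closure_torus[OF H]
        fixed_points_closure[OF assms H, of U] by simp
    moreover have "restrict f (lie_subalgebra H) =
        restrict (restrict f (lie_subalgebra (closure H))) (lie_subalgebra H)" for f :: "_ \<Rightarrow> real"
      using sub by (auto simp: restrict_def fun_eq_iff)
    ultimately show ?thesis
      unfolding locally_constant_on_def constant_on_def by metis
  qed
  then show ?thesis
    unfolding abstract_moment_map_def by blast
qed

end

theory Submission
  imports Defs
begin

text \<open>
  The infinitesimal generators \<open>A \<xi>\<close> of the action form a commuting family of linear operators, linear
  in \<open>\<xi>\<close>, and they are skew for an inner product obtained by averaging over the torus. The products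
  \<open>A \<xi> A \<eta>\<close> are therefore commuting symmetric operators, and splitting the space into their common
  eigenspaces gives projections \<open>P\<close> with sum $1$, weights \<open>\<alpha> P\<close> and operators \<open>J P\<close> such that
  \<open>A \<xi> P = (\<xi> \<bullet> \<alpha> P) J P\<close> and \<open>(J P)\<^sup>2 = - P\<close> whenever \<open>\<alpha> P \<noteq> 0\<close>; all of them commute with the group
  (\<open>isotypic_decomposition\<close>). Hence $\xi_M(x) = \sum_P (\xi \cdot \alpha_P) J_P x$. If
  $\Psi(x) = \sum_P f_P(x) \alpha_P$, it suffices to
  find a one-form taking the value $f_P(x)$ on each vector $J_P x$ with $\alpha_P \neq 0$.

  Such a form exists as soon as $f_P$ is smooth and vanishes where $P x = 0$. By Hadamard's formula
  $f_P(x) = f_P(x) - f_P(x - Px) = \int_0^1 df_P(x - sPx)(Px)\,ds$, and because $J_P J_P x = - Px$ the form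
  $\mu(x)(v) = - \sum_P \int_0^1 df_P(x - sPx)(J_P v)\,ds$ does what is required. It is built from
  invariant functions and equivariant operators, so it is invariant without any averaging.
  Dividing $f_P$ by $|Px|^2$ instead would fail: for the circle acting on $\mathbb C^2$ by scalars, where
  $P = 1$, the invariant function $\mathrm{Re}(z_1 \bar z_2)$ vanishes at the origin but is not a smooth
  multiple of $|z|^2$.

  The coefficients $f_P$ come from the moment map condition. If $\xi$ is orthogonal to all $\alpha_P$
  with $Px \neq 0$, then the one-parameter group of $\xi$ fixes the segment from $0$ to $x$. Local
  constancy on its fixed point set and $\Psi(0) = 0$ give $\Psi^\xi(x) = 0$. By duality $\Psi(x)$ lies in
  the span of the weights $\alpha_P$ with $Px \neq 0$. This span jumps with $x$, so a linear choice of
  coefficients is not available directly. Writing $\Psi(x) = \Psi(x - Px) + (\Psi(x) - \Psi(x - Px))$ for one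
  projection after another reduces to functions with values in a fixed span that vanish where one
  of the relevant components vanishes; for these, fixed linear functionals give the coefficients
  (\<open>weight_decomposition\<close>).
\<close>

section \<open>Calculus of smooth maps\<close>

lemma Ck_on_subset: "Ck_on k S f \<Longrightarrow> T \<subseteq> S \<Longrightarrow> Ck_on k T f"
  by (induction k arbitrary: f) (auto intro: continuous_on_subset)

lemma Ck_on_imp_continuous_on: "Ck_on k S f \<Longrightarrow> continuous_on S f"
  by (cases k) (auto intro!: continuous_at_imp_continuous_on differentiable_imp_continuous_within)

lemma Ck_on_cong:
  assumes "open S" "\<And>x. x \<in> S \<Longrightarrow> f x = g x" "Ck_on k S f"
  shows "Ck_on k S g"
  using assms(2,3)
proof (induction k arbitrary: f g)
  case 0
  then show ?case using continuous_on_cong by force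
next
  case (Suc k)
  have d: "g differentiable (at x)" if "x \<in> S" for x
    using Suc.prems that \<open>open S\<close> unfolding differentiable_def Ck_on.simps
    by (meson has_derivative_transform_within_open)
  have e: "frechet_derivative f (at x) = frechet_derivative g (at x)" if "x \<in> S" for x
    using Suc.prems that \<open>open S\<close> by (intro frechet_derivative_transform_within_open[of _ _ S]) auto
  have "Ck_on k S (\<lambda>x. frechet_derivative g (at x) v)" for v
  proof (rule Suc.IH)
    show "Ck_on k S (\<lambda>x. frechet_derivative f (at x) v)"
      using Suc.prems(2) by simp
  qed (simp only: e)
  with d show ?case by simp
qed

text \<open>
  The recursive step of \<open>Ck_on\<close> for a derivative known only on the open set itself, where it is given by
  a formula other than the Frechet derivative operator.
\<close>

lemma Ck_on_SucI:
  assumes "open S" "\<And>x. x \<in> S \<Longrightarrow> (f has_derivative f' x) (at x)" "\<And>v. Ck_on k S (\<lambda>x. f' x v)"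
  shows "Ck_on (Suc k) S f"
proof -
  have "f' x = frechet_derivative f (at x)" if "x \<in> S" for x
    using assms(2)[OF that] by (rule frechet_derivative_at)
  then have "Ck_on k S (\<lambda>x. frechet_derivative f (at x) v)" for v
    by (intro Ck_on_cong[OF \<open>open S\<close> _ assms(3)[of v]]) auto
  then show ?thesis
    using assms(2) by (auto simp: differentiable_def)
qed

lemma Ck_on_has_derivative:
  "Ck_on (Suc k) S f \<Longrightarrow> x \<in> S \<Longrightarrow> (f has_derivative frechet_derivative f (at x)) (at x)"
  by (simp add: frechet_derivative_works[symmetric])

lemma Ck_on_const: "open S \<Longrightarrow> Ck_on k S (\<lambda>x. c)"
proof (induction k arbitrary: c)
  case (Suc k)
  show ?case
    by (rule Ck_on_SucI[OF \<open>open S\<close>, where f' = "\<lambda>_ _. 0"]) (use Suc in auto)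
qed auto

lemma Ck_on_add:
  assumes "open S" "Ck_on k S f" "Ck_on k S g"
  shows "Ck_on k S (\<lambda>x. f x + g x)"
  using assms(2,3)
proof (induction k arbitrary: f g)
  case 0
  then show ?case by (auto intro: continuous_intros)
next
  case (Suc k)
  show ?case
    by (rule Ck_on_SucI[OF \<open>open S\<close> has_derivative_add[OF Ck_on_has_derivative[OF Suc.prems(1)]
          Ck_on_has_derivative[OF Suc.prems(2)]]])
       (use Suc in auto)
qed

lemma Ck_on_bounded_linear:
  assumes "open S" "Ck_on k S f" "bounded_linear L"
  shows "Ck_on k S (\<lambda>x. L (f x))"
  using assms(2)
proof (induction k arbitrary: f)
  case 0
  then show ?case by (auto intro: bounded_linear.continuous_on[OF assms(3)])
next
  case (Suc k)
  show ?case
    by (rule Ck_on_SucI[OF \<open>open S\<close> bounded_linear.has_derivative[OF assms(3) Ck_on_has_derivative[OF Suc.prems]]])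
       (use Suc in auto)
qed

lemma Ck_on_compose_bounded_linear:
  assumes "open S" "Ck_on k S f" "bounded_linear L" "open T" "L ` T \<subseteq> S"
  shows "Ck_on k T (\<lambda>x. f (L x))"
  using assms(2)
proof (induction k arbitrary: f)
  case 0
  then show ?case
    using assms continuous_on_compose2 linear_continuous_on by (metis Ck_on.simps(1))
next
  case (Suc k)
  have "((\<lambda>x. f (L x)) has_derivative (\<lambda>v. frechet_derivative f (at (L x)) (L v))) (at x)"
    if "x \<in> T" for x
    using Ck_on_has_derivative[OF Suc.prems, of "L x"] assms(5) that
      bounded_linear_imp_has_derivative[OF assms(3), of "at x"]
    by (auto intro: has_derivative_compose)
  then show ?case
    by (rule Ck_on_SucI[OF \<open>open T\<close>]) (use Suc in auto)
qed

lemma smooth_on_subset: "smooth_on S f \<Longrightarrow> T \<subseteq> S \<Longrightarrow> smooth_on T f"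
  unfolding smooth_on_def by (blast intro: Ck_on_subset)

lemma smooth_on_const: "open S \<Longrightarrow> smooth_on S (\<lambda>x. c)"
  unfolding smooth_on_def by (blast intro: Ck_on_const)

lemma smooth_on_add:
  "open S \<Longrightarrow> smooth_on S f \<Longrightarrow> smooth_on S g \<Longrightarrow> smooth_on S (\<lambda>x. f x + g x)"
  unfolding smooth_on_def by (blast intro: Ck_on_add)

lemma smooth_on_bounded_linear:
  "open S \<Longrightarrow> smooth_on S f \<Longrightarrow> bounded_linear L \<Longrightarrow> smooth_on S (\<lambda>x. L (f x))"
  unfolding smooth_on_def by (blast intro: Ck_on_bounded_linear)

lemma smooth_on_compose_bounded_linear:
  "open S \<Longrightarrow> smooth_on S f \<Longrightarrow> bounded_linear L \<Longrightarrow> open T \<Longrightarrow> L ` T \<subseteq> S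
    \<Longrightarrow> smooth_on T (\<lambda>x. f (L x))"
  unfolding smooth_on_def by (blast intro: Ck_on_compose_bounded_linear)

lemma smooth_on_diff:
  "open S \<Longrightarrow> smooth_on S f \<Longrightarrow> smooth_on S g \<Longrightarrow> smooth_on S (\<lambda>x. f x - g x)"
  using smooth_on_add[of S f "\<lambda>x. - g x"]
    smooth_on_bounded_linear[OF _ _ bounded_linear_minus[OF bounded_linear_ident], of S g] by simp

lemma smooth_on_sum:
  assumes "open S" "\<And>i. i \<in> I \<Longrightarrow> smooth_on S (f i)"
  shows "smooth_on S (\<lambda>x. \<Sum>i\<in>I. f i x)"
  using assms(2)
  by (induction I rule: infinite_finite_induct)
     (auto intro: smooth_on_add smooth_on_const \<open>open S\<close>)

lemma smooth_on_frechet_derivative: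
  "smooth_on S f \<Longrightarrow> smooth_on S (\<lambda>x. frechet_derivative f (at x) v)"
  unfolding smooth_on_def by (metis Ck_on.simps(2))

lemma smooth_on_has_derivative:
  "smooth_on S f \<Longrightarrow> x \<in> S \<Longrightarrow> (f has_derivative frechet_derivative f (at x)) (at x)"
  unfolding smooth_on_def by (blast intro: Ck_on_has_derivative[of 0])

lemma smooth_on_continuous_on: "smooth_on S f \<Longrightarrow> continuous_on S f"
  unfolding smooth_on_def by (blast intro: Ck_on_imp_continuous_on)

section \<open>Averages along segments\<close>

text \<open>
  Differentiating under the integral sign in the direction $v$ produces $v - s P v$, so a weight $s$
  appears under the integral. The induction on $k$ goes through because an arbitrary continuous
  weight \<open>\<rho>\<close> is allowed.
\<close>

lemma Ck_on_segment_average: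
  fixes P :: "'a::euclidean_space \<Rightarrow> 'a" and G :: "'a \<Rightarrow> 'b::euclidean_space"
  assumes "open V" "linear P"
    and seg: "\<And>x s. x \<in> V \<Longrightarrow> s \<in> {0..1} \<Longrightarrow> x - s *\<^sub>R P x \<in> V"
    and "continuous_on {0..1} \<rho>" "Ck_on k V G"
  shows "Ck_on k V (\<lambda>x. integral {0..1} (\<lambda>s. \<rho> s *\<^sub>R G (x - s *\<^sub>R P x)))"
proof -
  have bl: "bounded_linear P" using \<open>linear P\<close> by (simp add: linear_conv_bounded_linear)
  have seg_cont: "continuous_on (V \<times> {0..1}) (\<lambda>p. fst p - snd p *\<^sub>R P (fst p))"
    by (intro continuous_intros bounded_linear.continuous_on[OF bl])
  have cont2: "continuous_on (V \<times> {0..1}) (\<lambda>p. H (fst p - snd p *\<^sub>R P (fst p)))"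
    if "continuous_on V H" for H :: "'a \<Rightarrow> 'c::topological_space"
    using seg by (intro continuous_on_compose2[OF that seg_cont]) auto
  have cont1: "continuous_on {0..1} (\<lambda>s. H (x - s *\<^sub>R P x))"
    if "continuous_on V H" "x \<in> V" for H :: "'a \<Rightarrow> 'c::topological_space" and x
    using seg that(2) by (intro continuous_on_compose2[OF that(1)] continuous_intros) auto
  have contr: "continuous_on (V \<times> {0..1}) (\<lambda>p. \<rho> (snd p))"
    if "continuous_on {0..1} \<rho>" for \<rho> :: "real \<Rightarrow> real"
    by (intro continuous_on_compose2[OF that] continuous_intros) auto
  show ?thesis using assms(4,5)
  proof (induction k arbitrary: G \<rho>)
    case 0
    have "continuous_on (V \<times> {0..1}) (\<lambda>(x, s). \<rho> s *\<^sub>R G (x - s *\<^sub>R P x))"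
      unfolding case_prod_beta using 0 by (intro continuous_intros cont2 contr) auto
    then show ?case
      using integral_continuous_on_param[of V 0 "1::real" "\<lambda>x s. \<rho> s *\<^sub>R G (x - s *\<^sub>R P x)"] by simp
  next
    case (Suc k)
    define D where "D x = Blinfun (frechet_derivative G (at x))" for x
    have D: "(G has_derivative blinfun_apply (D x)) (at x)" if "x \<in> V" for x
      using Ck_on_has_derivative[OF Suc.prems(2) that]
      by (simp add: D_def bounded_linear_Blinfun_apply has_derivative_bounded_linear)
    have D': "D x v = frechet_derivative G (at x) v" if "x \<in> V" for x v
      using D[OF that] frechet_derivative_at by metis
    have contD: "continuous_on V D"
    proof (rule continuous_on_blinfun_componentwise)
      fix i :: 'a
      have "continuous_on V (\<lambda>x. frechet_derivative G (at x) i)"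
        using Suc.prems(2) by (auto intro: Ck_on_imp_continuous_on)
      then show "continuous_on V (\<lambda>x. D x i)"
        using D' continuous_on_cong by force
    qed
    define E where "E x s = \<rho> s *\<^sub>R (D (x - s *\<^sub>R P x) o\<^sub>L (id_blinfun - s *\<^sub>R Blinfun P))" for x s
    have E: "E x s v = \<rho> s *\<^sub>R D (x - s *\<^sub>R P x) (v - s *\<^sub>R P v)" for x s v
      by (simp add: E_def blinfun.bilinear_simps bounded_linear_Blinfun_apply bl)
    have cE: "continuous_on (V \<times> {0..1}) (\<lambda>(x, s). E x s)"
      unfolding case_prod_beta E_def using contD Suc.prems(1)
      by (intro continuous_intros cont2 contr bounded_bilinear.continuous_on[OF bounded_bilinear_blinfun_compose])
    have dE: "((\<lambda>x. \<rho> s *\<^sub>R G (x - s *\<^sub>R P x)) has_derivative E x s) (at x within W)"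
      if "x \<in> V" "s \<in> {0..1}" for x s W
    proof -
      have "((\<lambda>x. x - s *\<^sub>R P x) has_derivative (\<lambda>v. v - s *\<^sub>R P v)) (at x within W)"
        by (intro derivative_intros bounded_linear_imp_has_derivative bl)
      from has_derivative_compose[OF this D[OF seg[OF that]]]
      show ?thesis unfolding E[abs_def] by (intro derivative_intros)
    qed
    have int: "(\<lambda>s. \<rho> s *\<^sub>R G (x - s *\<^sub>R P x)) integrable_on cbox 0 1" if "x \<in> V" for x
      unfolding cbox_interval using Suc.prems(1) Ck_on_imp_continuous_on[OF Suc.prems(2)] that
      by (intro integrable_continuous_real continuous_on_scaleR cont1) auto
    \<comment> \<open>The Leibniz rule needs a convex domain, hence the passage to a ball around the point.\<close>
    have main: "((\<lambda>x. integral {0..1} (\<lambda>s. \<rho> s *\<^sub>R G (x - s *\<^sub>R P x))) has_derivative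
          blinfun_apply (integral {0..1} (E x))) (at x)" if x: "x \<in> V" for x
    proof -
      from x \<open>open V\<close> obtain r where r: "r > 0" "ball x r \<subseteq> V" by (meson open_contains_ball)
      have "((\<lambda>x. integral (cbox 0 1) (\<lambda>s. \<rho> s *\<^sub>R G (x - s *\<^sub>R P x))) has_derivative
          blinfun_apply (integral (cbox 0 1) (E x))) (at x within ball x r)"
      proof (rule leibniz_rule)
        show "continuous_on (ball x r \<times> cbox 0 1) (\<lambda>(x, s). E x s)"
          using r by (intro continuous_on_subset[OF cE]) auto
      qed (use r dE int in auto)
      moreover have "at x within ball x r = at x"
        using r by (intro at_within_open) auto
      ultimately show ?thesis by (simp only: cbox_interval)
    qed
    have Ei: "blinfun_apply (integral {0..1} (E x)) v =
        integral {0..1} (\<lambda>s. \<rho> s *\<^sub>R frechet_derivative G (at (x - s *\<^sub>R P x)) v)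
        + integral {0..1} (\<lambda>s. (- (\<rho> s * s)) *\<^sub>R frechet_derivative G (at (x - s *\<^sub>R P x)) (P v))"
      if x: "x \<in> V" for x v
    proof -
      have "continuous_on {0..1} (E x)"
        using continuous_on_compose2[OF cE continuous_on_Pair[OF continuous_on_const[of _ x] continuous_on_id], of "{0..1}"] x
        by auto
      then have "blinfun_apply (integral {0..1} (E x)) v = integral {0..1} (\<lambda>s. E x s v)"
        by (simp add: blinfun_apply_integral integrable_continuous_real)
      also have "\<dots> = integral {0..1} (\<lambda>s. \<rho> s *\<^sub>R D (x - s *\<^sub>R P x) v +
          (- (\<rho> s * s)) *\<^sub>R D (x - s *\<^sub>R P x) (P v))"
        unfolding E by (intro integral_cong) (simp add: blinfun.bilinear_simps algebra_simps)
      also have "\<dots> = integral {0..1} (\<lambda>s. \<rho> s *\<^sub>R D (x - s *\<^sub>R P x) v) +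
          integral {0..1} (\<lambda>s. (- (\<rho> s * s)) *\<^sub>R D (x - s *\<^sub>R P x) (P v))"
        using cont1[OF contD x] Suc.prems(1)
        by (intro integral_add integrable_continuous_real continuous_intros) auto
      also have "\<dots> = integral {0..1} (\<lambda>s. \<rho> s *\<^sub>R frechet_derivative G (at (x - s *\<^sub>R P x)) v)
        + integral {0..1} (\<lambda>s. (- (\<rho> s * s)) *\<^sub>R frechet_derivative G (at (x - s *\<^sub>R P x)) (P v))"
        using D'[OF seg[OF x]] by (intro arg_cong2[of _ _ _ _ "(+)"] integral_cong) simp_all
      finally show ?thesis .
    qed
    show ?case
    proof (rule Ck_on_SucI[OF \<open>open V\<close> main])
      fix v
      have "Ck_on k V (\<lambda>x. integral {0..1} (\<lambda>s. \<rho> s *\<^sub>R frechet_derivative G (at (x - s *\<^sub>R P x)) v)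
        + integral {0..1} (\<lambda>s. (- (\<rho> s * s)) *\<^sub>R frechet_derivative G (at (x - s *\<^sub>R P x)) (P v)))"
        using Suc.prems by (intro Ck_on_add \<open>open V\<close> Suc.IH) (auto intro!: continuous_intros)
      then show "Ck_on k V (\<lambda>x. blinfun_apply (integral {0..1} (E x)) v)"
        by (rule Ck_on_cong[OF \<open>open V\<close>, rotated]) (simp add: Ei)
    qed
  qed
qed

lemma smooth_on_segment_average:
  fixes P :: "'a::euclidean_space \<Rightarrow> 'a" and G :: "'a \<Rightarrow> 'b::euclidean_space"
  assumes "open V" "linear P"
    and "\<And>x s. x \<in> V \<Longrightarrow> s \<in> {0..1} \<Longrightarrow> x - s *\<^sub>R P x \<in> V"
    and "smooth_on V G"
  shows "smooth_on V (\<lambda>x. integral {0..1} (\<lambda>s. G (x - s *\<^sub>R P x)))"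
  using Ck_on_segment_average[of V P "\<lambda>_. 1" _ G] assms unfolding smooth_on_def by simp

text \<open>
  Hadamard's formula: the derivative of \<open>f\<close> along the segment from $x$ to $x - Px$, integrated.
\<close>

lemma segment_average_derivative:
  fixes P :: "'a::euclidean_space \<Rightarrow> 'a" and f :: "'a \<Rightarrow> real"
  assumes "linear P"
    and seg: "\<And>s. s \<in> {0..1} \<Longrightarrow> x - s *\<^sub>R P x \<in> V"
    and "smooth_on V f"
  shows "integral {0..1} (\<lambda>s. frechet_derivative f (at (x - s *\<^sub>R P x)) (P x)) = f x - f (x - P x)"
proof -
  have "((\<lambda>s. - frechet_derivative f (at (x - s *\<^sub>R P x)) (P x)) has_integral
      f (x - 1 *\<^sub>R P x) - f (x - 0 *\<^sub>R P x)) {0..1}"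
  proof (rule fundamental_theorem_of_calculus)
    fix s :: real assume s: "s \<in> {0..1}"
    have d: "(f has_derivative frechet_derivative f (at (x - s *\<^sub>R P x))) (at (x - s *\<^sub>R P x))"
      using assms(3) seg[OF s] by (rule smooth_on_has_derivative)
    have "((\<lambda>s. x - s *\<^sub>R P x) has_derivative (\<lambda>h. - (h *\<^sub>R P x))) (at s within {0..1})"
      by (auto intro!: derivative_eq_intros)
    from has_derivative_compose[OF this d]
    show "((\<lambda>s. f (x - s *\<^sub>R P x)) has_vector_derivative
        - frechet_derivative f (at (x - s *\<^sub>R P x)) (P x)) (at s within {0..1})"
      using has_derivative_linear[OF d]
      by (simp add: has_vector_derivative_def linear_neg linear_scale)
  qed simp
  from has_integral_neg[OF this] show ?thesis
    by (simp add: integral_unique)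
qed


section \<open>Commuting families of skew operators\<close>

definition inner_form :: "('a::euclidean_space \<Rightarrow> 'a \<Rightarrow> real) \<Rightarrow> bool" where
  "inner_form q \<longleftrightarrow> bilinear q \<and> (\<forall>x y. q x y = q y x) \<and> (\<forall>x. x \<noteq> 0 \<longrightarrow> q x x > 0)"

lemma inner_formD:
  assumes "inner_form q"
  shows "bilinear q" "q x y = q y x" "x \<noteq> 0 \<Longrightarrow> q x x > 0"
  using assms by (auto simp: inner_form_def)

lemma inner_form_eq_0: "inner_form q \<Longrightarrow> q x x = 0 \<Longrightarrow> x = 0"
  using inner_formD(3) by fastforce

lemma inner_form_nonneg: "inner_form q \<Longrightarrow> q x x \<ge> 0"
  by (cases "x = 0") (auto dest: inner_formD intro: less_imp_le simp: bilinear_lzero)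

lemma inner_form_continuous:
  assumes "inner_form q" "continuous_on S f" "continuous_on S g"
  shows "continuous_on S (\<lambda>x. q (f x) (g x))"
  using inner_formD(1)[OF assms(1)] assms(2,3)
  by (simp add: bilinear_conv_bounded_bilinear bounded_bilinear.continuous_on)

lemma inner_form_coercive:
  fixes q :: "'a::euclidean_space \<Rightarrow> 'a \<Rightarrow> real"
  assumes "inner_form q"
  obtains c where "c > 0" "\<And>x. c * (norm x)\<^sup>2 \<le> q x x"
proof -
  note bil = inner_formD(1)[OF assms]
  have "\<exists>x\<in>sphere 0 1. \<forall>y\<in>sphere 0 1. q x x \<le> q y y"
    by (rule continuous_attains_inf) (auto intro!: inner_form_continuous[OF assms] continuous_on_id)
  then obtain x where x: "norm x = 1" "\<And>y. norm y = 1 \<Longrightarrow> q x x \<le> q y y" by auto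
  show ?thesis
  proof (rule that[of "q x x"])
    show "q x x > 0" using x(1) by (intro inner_formD(3)[OF assms]) auto
    show "q x x * (norm y)\<^sup>2 \<le> q y y" for y
    proof (cases "y = 0")
      case False
      then have "q x x \<le> q (y /\<^sub>R norm y) (y /\<^sub>R norm y)" by (intro x(2)) simp
      then show ?thesis
        using False by (simp add: bilinear_lmul[OF bil] bilinear_rmul[OF bil] field_simps power2_eq_square)
    qed (simp add: bilinear_lzero[OF bil])
  qed
qed


lemma nonneg_quadratic_imp_linear_term_0:
  fixes b c :: real
  assumes "c \<ge> 0" "\<And>t. 0 \<le> 2 * t * b + t\<^sup>2 * c"
  shows "b = 0"
proof (rule ccontr)
  assume "b \<noteq> 0"
  have "2 * (- b / (c + 1)) * b + (- b / (c + 1))\<^sup>2 * c = - (b\<^sup>2 * (c + 2) / (c + 1)\<^sup>2)"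
    using \<open>c \<ge> 0\<close> by (simp add: divide_simps power2_eq_square) (simp add: algebra_simps)
  moreover have "b\<^sup>2 * (c + 2) / (c + 1)\<^sup>2 > 0"
    using \<open>b \<noteq> 0\<close> \<open>c \<ge> 0\<close> by (auto intro!: divide_pos_pos mult_pos_pos)
  ultimately show False
    using assms(2)[of "- b / (c + 1)"] by linarith
qed

text \<open>
  A maximum point of the Rayleigh quotient on the unit sphere of the subspace is an eigenvector. If
  $l$ is the maximum, then $l\,q(y,y) - q(Sy,y)$ is nonnegative on the subspace and zero at the maximum
  point $x$, so it has no linear term there; in the direction $l x - S x$ that term is
  $q(l x - S x, l x - S x)$.
\<close>

lemma symmetric_operator_has_eigenvector:
  fixes q :: "'a::euclidean_space \<Rightarrow> 'a \<Rightarrow> real"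
  assumes q: "inner_form q" and W: "subspace W" "W \<noteq> {0}"
    and S: "linear S" "S ` W \<subseteq> W" and sym: "\<And>x y. q (S x) y = q x (S y)"
  obtains l x where "x \<in> W" "x \<noteq> 0" "S x = l *\<^sub>R x"
proof -
  note bil = inner_formD(1)[OF q]
  define K where "K = W \<inter> sphere 0 1"
  have "compact K"
    unfolding K_def using closed_subspace[OF W(1)] by (simp add: closed_Int_compact)
  moreover have "K \<noteq> {}"
  proof -
    obtain w where "w \<in> W" "w \<noteq> 0" using W subspace_0 by blast
    then have "w /\<^sub>R norm w \<in> K" by (auto simp: K_def W(1) subspace_scale)
    then show ?thesis by auto
  qed
  moreover have "continuous_on K (\<lambda>x. q (S x) x / q x x)"
  proof -
    have "q x x \<noteq> 0" if "x \<in> K" for x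
    proof -
      have "x \<noteq> 0" using that by (auto simp: K_def)
      then show ?thesis using inner_formD(3)[OF q] by fastforce
    qed
    moreover have "continuous_on K S"
      using S(1) by (simp add: linear_continuous_on linear_conv_bounded_linear)
    ultimately show ?thesis
      by (intro continuous_on_divide inner_form_continuous[OF q] continuous_on_id ballI)
  qed
  ultimately have "\<exists>x\<in>K. \<forall>y\<in>K. q (S y) y / q y y \<le> q (S x) x / q x x"
    by (rule continuous_attains_sup)
  then obtain x where x: "x \<in> K" and max: "\<And>y. y \<in> K \<Longrightarrow> q (S y) y / q y y \<le> q (S x) x / q x x"
    by blast
  define l where "l = q (S x) x / q x x"
  have x': "x \<in> W" "x \<noteq> 0" using x by (auto simp: K_def)
  have max': "q (S y) y \<le> l * q y y" if "y \<in> W" for y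
  proof (cases "y = 0")
    case True
    then show ?thesis by (simp add: bilinear_rzero[OF bil])
  next
    case False
    then have "y /\<^sub>R norm y \<in> K" using that by (auto simp: K_def W(1) subspace_scale)
    from max[OF this] have "q (S y) y / q y y \<le> l"
      using False by (simp add: linear_scale[OF S(1)] bilinear_lmul[OF bil] bilinear_rmul[OF bil] l_def)
    then show ?thesis using inner_formD(3)[OF q False] by (simp add: divide_le_eq)
  qed
  define z where "z = l *\<^sub>R x - S x"
  have zW: "z \<in> W" using x' S(2) W(1) by (auto simp: z_def intro!: subspace_diff subspace_scale)
  have "q z z = 0"
  proof (rule nonneg_quadratic_imp_linear_term_0)
    show "0 \<le> l * q z z - q (S z) z" using max'[OF zW] by simp
    fix t :: real
    have "x + t *\<^sub>R z \<in> W" using x' zW W(1) by (auto intro!: subspace_add subspace_scale)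
    from max'[OF this] have "0 \<le> l * q (x + t *\<^sub>R z) (x + t *\<^sub>R z) - q (S (x + t *\<^sub>R z)) (x + t *\<^sub>R z)"
      by simp
    also have "\<dots> = (l * q x x - q (S x) x) + t * (l * q x z - q (S x) z) + t * (l * q z x - q (S z) x)
        + t\<^sup>2 * (l * q z z - q (S z) z)"
      by (simp add: linear_add[OF S(1)] linear_scale[OF S(1)] bilinear_ladd[OF bil] bilinear_radd[OF bil]
          bilinear_lmul[OF bil] bilinear_rmul[OF bil] algebra_simps power2_eq_square)
    also have "l * q x x - q (S x) x = 0"
      using inner_formD(3)[OF q x'(2)] by (simp add: l_def)
    also have "l * q z x - q (S z) x = l * q x z - q (S x) z"
      using inner_formD(2)[OF q] sym by metis
    also have "l * q x z - q (S x) z = q z z"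
      by (subst (3) z_def) (simp add: bilinear_lsub[OF bil] bilinear_lmul[OF bil])
    finally show "0 \<le> 2 * t * q z z + t\<^sup>2 * (l * q z z - q (S z) z)"
      by (simp add: algebra_simps)
  qed
  then have "S x = l *\<^sub>R x"
    using inner_form_eq_0[OF q, of z] by (simp add: z_def)
  with x' show ?thesis by (rule that)
qed

text \<open>
  A symmetric operator has kernel and range orthogonal, so the space is their direct sum. The
  projection onto the kernel along the range is determined by \<open>T\<close> alone, which is why it commutes with
  every operator that commutes with \<open>T\<close>.
\<close>

lemma symmetric_operator_kernel_projection:
  fixes q :: "'a::euclidean_space \<Rightarrow> 'a \<Rightarrow> real"
  assumes q: "inner_form q" and T: "linear T" and sym: "\<And>x y. q (T x) y = q x (T y)"
  shows "\<exists>Q. linear Q \<and> (\<forall>x. Q (Q x) = Q x) \<and> (\<forall>x. T (Q x) = 0) \<and> (\<forall>x. T x = 0 \<longrightarrow> Q x = x) \<and>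
    (\<forall>x y. q (Q x) y = q x (Q y)) \<and>
    (\<forall>L. linear L \<longrightarrow> (\<forall>x. L (T x) = T (L x)) \<longrightarrow> (\<forall>x. L (Q x) = Q (L x)))"
proof -
  note bil = inner_formD(1)[OF q]
  have orth: "q x (T y) = 0" if "T x = 0" for x y
    using that by (simp add: sym[symmetric] bilinear_lzero[OF bil])
  have triv: "x = 0" if "T x = 0" "x \<in> range T" for x
    using that orth[of x] inner_form_eq_0[OF q] by blast
  have "inj_on T (range T)"
  proof (rule inj_onI)
    fix x y assume "x \<in> range T" "y \<in> range T" and *: "T x = T y"
    then have "x - y \<in> range T" using T by (auto simp: linear_diff[symmetric])
    moreover have "T (x - y) = 0" using * T by (simp add: linear_diff)
    ultimately show "x = y" using triv by fastforce
  qed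
  then have "dim (T ` range T) = dim (range T)"
    using T subspace_UNIV by (intro dim_image_eq) (auto simp: span_eq_iff[THEN iffD2] linear_subspace_image)
  \<comment> \<open>Injectivity on the range makes the range of the square as large as the range itself.\<close>
  then have im: "T ` range T = range T"
    using T by (intro subspace_dim_equal) (auto simp: linear_subspace_image)
  have ex: "\<exists>k. T k = 0 \<and> x - k \<in> range T" for x
  proof -
    obtain z where "T x = T (T z)" using im by (metis imageE rangeI)
    then show ?thesis by (intro exI[of _ "x - T z"]) (use T in \<open>auto simp: linear_diff\<close>)
  qed
  define Q where "Q x = (SOME k. T k = 0 \<and> x - k \<in> range T)" for x
  have Q: "T (Q x) = 0" "x - Q x \<in> range T" for x
    using someI_ex[OF ex[of x]] by (auto simp: Q_def)
  have uniq: "Q x = k" if "T k = 0" "x - k \<in> range T" for x k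
  proof -
    have "T (Q x - k) = 0" using Q that T by (simp add: linear_diff)
    moreover have "Q x - k = (x - k) - (x - Q x)" by simp
    then have "Q x - k \<in> range T"
      using that(2) Q(2)[of x] T by (metis linear_subspace_image subspace_UNIV subspace_diff)
    ultimately show ?thesis using triv by fastforce
  qed
  have sub: "subspace (range T)" using T by (simp add: linear_subspace_image)
  show ?thesis
  proof (intro exI[of _ Q] conjI allI impI)
    show "linear Q"
    proof (rule linearI)
      show "Q (x + y) = Q x + Q y" for x y
      proof (rule uniq)
        have "(x + y) - (Q x + Q y) = (x - Q x) + (y - Q y)" by simp
        then show "(x + y) - (Q x + Q y) \<in> range T" using sub Q by (metis subspace_add)
      qed (use Q T in \<open>simp add: linear_add\<close>)
      show "Q (c *\<^sub>R x) = c *\<^sub>R Q x" for c x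
      proof (rule uniq)
        have "c *\<^sub>R x - c *\<^sub>R Q x = c *\<^sub>R (x - Q x)" by (simp add: algebra_simps)
        then show "c *\<^sub>R x - c *\<^sub>R Q x \<in> range T" using sub Q by (metis subspace_scale)
      qed (use Q T in \<open>simp add: linear_scale\<close>)
    qed
    show fix_ker: "Q x = x" if "T x = 0" for x
      using that subspace_0[OF sub] by (intro uniq) auto
    show "Q (Q x) = Q x" for x using Q by (intro fix_ker)
    show "T (Q x) = 0" for x by (rule Q)
    show "q (Q x) y = q x (Q y)" for x y
    proof -
      have *: "q (Q x) (y - Q y) = 0" for x y using orth[OF Q(1)] Q(2)[of y] by auto
      have "q (Q x) y = q (Q x) (Q y)"
        using *[of x y] by (simp add: bilinear_rsub[OF bil])
      also have "\<dots> = q x (Q y)"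
        using *[of y x] inner_formD(2)[OF q] by (simp add: bilinear_rsub[OF bil])
      finally show ?thesis .
    qed
    show "L (Q x) = Q (L x)" if L: "linear L" "\<forall>x. L (T x) = T (L x)" for L x
    proof (rule uniq[symmetric])
      show "T (L (Q x)) = 0" using L Q by (metis linear_0)
      obtain z where "x - Q x = T z" using Q(2) by blast
      then have "L x - L (Q x) = T (L z)" using L by (metis linear_diff)
      then show "L x - L (Q x) \<in> range T" by auto
    qed
  qed
qed

definition commutant :: "('i \<Rightarrow> 'a::real_vector \<Rightarrow> 'a) \<Rightarrow> ('a \<Rightarrow> 'a) set" where
  "commutant A = {L. linear L \<and> (\<forall>i x. L (A i x) = A i (L x))}"

text \<open>
  Projections that are symmetric and commute with everything that commutes with the family. The
  last property makes every such projection equivariant for a group that commutes with \<open>A\<close>.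
\<close>

definition natural_projection ::
    "('a::euclidean_space \<Rightarrow> 'a \<Rightarrow> real) \<Rightarrow> ('i \<Rightarrow> 'a \<Rightarrow> 'a) \<Rightarrow> ('a \<Rightarrow> 'a) \<Rightarrow> bool" where
  "natural_projection q A P \<longleftrightarrow> linear P \<and> (\<forall>x. P (P x) = P x) \<and> (\<forall>x y. q (P x) y = q x (P y)) \<and>
     (\<forall>L\<in>commutant A. \<forall>x. L (P x) = P (L x))"

lemma natural_projectionD:
  assumes "natural_projection q A P"
  shows "linear P" "P (P x) = P x" "q (P x) y = q x (P y)" "L \<in> commutant A \<Longrightarrow> L (P x) = P (L x)"
  using assms by (auto simp: natural_projection_def)

locale commuting_skew_family =
  fixes q :: "'a::euclidean_space \<Rightarrow> 'a \<Rightarrow> real" and A :: "'i \<Rightarrow> 'a \<Rightarrow> 'a"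
  assumes q: "inner_form q" and linear: "linear (A i)"
    and commute: "A i (A j x) = A j (A i x)" and skew: "q (A i x) y = - q x (A i y)"
begin

lemma in_commutant: "A i \<in> commutant A"
  by (simp add: commutant_def linear commute)

lemma projection_in_commutant: "natural_projection q A P \<Longrightarrow> P \<in> commutant A"
  using in_commutant by (auto simp: natural_projection_def commutant_def)

definition isotypic_family :: "('a \<Rightarrow> 'a) \<Rightarrow> ('a \<Rightarrow> 'a) set \<Rightarrow> bool" where
  "isotypic_family P \<P> \<longleftrightarrow> finite \<P> \<and>
    (\<forall>Q\<in>\<P>. natural_projection q A Q \<and> (\<forall>x. P (Q x) = Q x) \<and>
       (\<forall>i j. \<exists>c. \<forall>x. A i (A j (Q x)) = c *\<^sub>R Q x)) \<and>
    (\<forall>Q\<in>\<P>. \<forall>R\<in>\<P>. Q \<noteq> R \<longrightarrow> (\<forall>x. Q (R x) = 0)) \<and> (\<forall>x. (\<Sum>Q\<in>\<P>. Q x) = P x)"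

lemma isotypic_familyD:
  assumes "isotypic_family P \<P>"
  shows "finite \<P>" "F \<in> \<P> \<Longrightarrow> natural_projection q A F" "F \<in> \<P> \<Longrightarrow> P (F x) = F x"
    "F \<in> \<P> \<Longrightarrow> \<exists>c. \<forall>x. A i (A j (F x)) = c *\<^sub>R F x"
    "F \<in> \<P> \<Longrightarrow> G \<in> \<P> \<Longrightarrow> F \<noteq> G \<Longrightarrow> F (G x) = 0" "(\<Sum>F\<in>\<P>. F x) = P x"
  using assms unfolding isotypic_family_def by blast+

text \<open>
  As long as some product \<open>A i A j\<close> is not a scalar on the range of \<open>P\<close>, an eigenvalue $l$ of it splits
  \<open>P\<close> into the projection \<open>Q\<close> onto the eigenspace and the rest \<open>P - Q\<close>, both of smaller rank.
\<close>

lemma isotypic_splitting: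
  assumes "natural_projection q A P"
  shows "\<exists>\<P>. isotypic_family P \<P>"
  using assms
proof (induction "dim (range P)" arbitrary: P rule: less_induct)
  case less
  note P = natural_projectionD[OF less.prems]
  note bil = inner_formD(1)[OF q]
  show ?case
  proof (cases "\<forall>i j. \<exists>c. \<forall>x. A i (A j (P x)) = c *\<^sub>R P x")
    case True
    then show ?thesis using less.prems P by (intro exI[of _ "{P}"]) (auto simp: isotypic_family_def)
  next
    case False
    then obtain i j where ij: "\<And>c. \<exists>x. A i (A j (P x)) \<noteq> c *\<^sub>R P x" by blast
    define S where "S x = A i (A j x)" for x
    have S: "linear S"
      unfolding S_def using linear_compose[OF linear[of j] linear[of i]] by (simp add: o_def)
    have Ssym: "q (S x) y = q x (S y)" for x y
      unfolding S_def by (simp add: skew) (simp add: commute)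
    have SP: "S (P x) = P (S x)" for x
      unfolding S_def by (simp add: P(4)[OF in_commutant])
    obtain l x0 where x0: "x0 \<in> range P" "x0 \<noteq> 0" "S x0 = l *\<^sub>R x0"
    proof (rule symmetric_operator_has_eigenvector[OF q _ _ S _ Ssym, of "range P"])
      show "range P \<noteq> {0}"
      proof
        assume "range P = {0}"
        then have "P x = 0" for x by auto
        then show False using ij[of 0] linear_0[OF linear] by auto
      qed
    qed (use SP in \<open>auto intro: linear_subspace_image P(1)\<close>)
    \<comment> \<open>Adding the complement of \<open>P\<close> makes the kernel of \<open>T\<close> the \<open>l\<close>-eigenspace of \<open>S\<close> inside the range of \<open>P\<close>.\<close>
    define T where "T x = S (P x) - l *\<^sub>R P x + (x - P x)" for x
    have T: "linear T"
      unfolding T_def by (rule linearI) (simp_all add: P(1) S linear_add linear_scale algebra_simps)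
    have Tsym: "q (T x) y = q x (T y)" for x y
    proof -
      have "q (S (P x)) y = q x (S (P y))"
        by (simp add: Ssym P(3)) (simp add: SP)
      then show ?thesis
        unfolding T_def using P(3)[of x y]
        by (simp add: bilinear_ladd[OF bil] bilinear_radd[OF bil] bilinear_lsub[OF bil]
          bilinear_rsub[OF bil] bilinear_lmul[OF bil] bilinear_rmul[OF bil])
    qed
    have Tcomm: "L (T x) = T (L x)" if "L \<in> commutant A" for L x
    proof -
      have L: "linear L" "\<And>i x. L (A i x) = A i (L x)" using that by (auto simp: commutant_def)
      show ?thesis
        unfolding T_def S_def
        by (simp add: L linear_add linear_diff linear_scale P(4)[OF that])
    qed
    have kerT: "T x = 0 \<longleftrightarrow> P x = x \<and> S x = l *\<^sub>R x" for x
    proof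
      assume "T x = 0"
      moreover have "P (T x) = S (P x) - l *\<^sub>R P x"
        by (simp add: T_def linear_add linear_diff linear_scale P(1,2) SP)
      ultimately have "S (P x) - l *\<^sub>R P x = 0" by (simp add: linear_0[OF P(1)])
      with \<open>T x = 0\<close> show "P x = x \<and> S x = l *\<^sub>R x" by (simp add: T_def)
    qed (simp add: T_def)
    obtain Q where Q: "linear Q" "\<And>x. Q (Q x) = Q x" "\<And>x. T (Q x) = 0" "\<And>x. T x = 0 \<Longrightarrow> Q x = x"
      "\<And>x y. q (Q x) y = q x (Q y)"
      "\<And>L x. linear L \<Longrightarrow> (\<forall>x. L (T x) = T (L x)) \<Longrightarrow> L (Q x) = Q (L x)"
      using symmetric_operator_kernel_projection[OF q T Tsym] by blast
    have natQ: "natural_projection q A Q"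
      unfolding natural_projection_def using Q Tcomm by (auto simp: commutant_def)
    have PQ: "P (Q x) = Q x" and SQ: "S (Q x) = l *\<^sub>R Q x" for x
      using Q(3) kerT by auto
    have QP: "Q (P x) = Q x" for x
      using natural_projectionD(4)[OF natQ projection_in_commutant[OF less.prems]] PQ by metis
    define R where "R x = P x - Q x" for x
    have natR: "natural_projection q A R"
      unfolding natural_projection_def
    proof (intro conjI allI ballI)
      show "linear R"
        unfolding R_def by (rule linear_compose_sub[OF P(1) Q(1)])
      show "R (R x) = R x" for x
        by (simp add: R_def linear_diff P(1,2) Q(1,2) PQ QP)
      show "q (R x) y = q x (R y)" for x y
        by (simp add: R_def bilinear_lsub[OF bil] bilinear_rsub[OF bil] P(3) Q(5))
      show "L (R x) = R (L x)" if "L \<in> commutant A" for L x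
        using that natural_projectionD(4)[OF natQ that] P(4)[OF that]
        by (simp add: R_def linear_diff commutant_def)
    qed
    have PR: "P (R x) = R x" and QR: "Q (R x) = 0" and RQ: "R (Q x) = 0" for x
      by (simp_all add: R_def linear_diff P(1,2) Q(1,2) PQ QP)
    have dimQ: "dim (range Q) < dim (range P)"
    proof (rule dim_psubset)
      have "range Q \<subseteq> range P" using PQ by (metis image_subsetI rangeI)
      moreover have "range Q \<noteq> range P"
      proof
        assume "range Q = range P"
        then have "Q (P x) = P x" for x using Q(2) by (metis rangeE rangeI)
        then show False using ij[of l] SQ by (metis S_def)
      qed
      ultimately show "span (range Q) \<subset> span (range P)"
        by (simp add: span_eq_iff[THEN iffD2] linear_subspace_image P(1) Q(1) psubset_eq)
    qed
    have dimR: "dim (range R) < dim (range P)"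
    proof (rule dim_psubset)
      have "range R \<subseteq> range P" using PR by (metis image_subsetI rangeI)
      moreover have "x0 \<notin> range R"
      proof
        assume "x0 \<in> range R"
        then have "R x0 = x0" using natural_projectionD(2)[OF natR] by auto
        moreover have "P x0 = x0" using x0(1) P(2) by auto
        moreover have "Q x0 = x0" using \<open>P x0 = x0\<close> x0(3) kerT by (intro Q(4)) auto
        ultimately show False using x0(2) by (simp add: R_def)
      qed
      ultimately show "span (range R) \<subset> span (range P)"
        using x0(1) natural_projectionD(1)[OF natR]
        by (simp add: span_eq_iff[THEN iffD2] linear_subspace_image P(1)) blast
    qed
    obtain \<Q> \<R> where fam: "isotypic_family Q \<Q>" "isotypic_family R \<R>"
      using less.hyps[OF dimQ natQ] less.hyps[OF dimR natR] by blast
    note \<Q> = isotypic_familyD[OF fam(1)] and \<R> = isotypic_familyD[OF fam(2)]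
    have cross: "F (G x) = 0" "G (F x) = 0" if "F \<in> \<Q>" "G \<in> \<R>" for F G x
    proof -
      have "F (G x) = F (Q (G x))"
        by (metis natural_projectionD(4)[OF \<Q>(2)[OF that(1)] projection_in_commutant[OF natQ]] \<Q>(3)[OF that(1)])
      also have "Q (G x) = 0"
        using QR[of "G x"] \<R>(3)[OF that(2), of x] by simp
      finally show *: "F (G x) = 0" by (simp add: linear_0 natural_projectionD(1)[OF \<Q>(2)[OF that(1)]])
      show "G (F x) = 0"
        using * natural_projectionD(4)[OF \<R>(2)[OF that(2)] projection_in_commutant[OF \<Q>(2)[OF that(1)]], of x]
        by simp
    qed
    have inter: "F x = 0" if "F \<in> \<Q> \<inter> \<R>" for F x
      using cross[of F F x] that natural_projectionD(2)[OF \<Q>(2), of F x] by auto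
    have "(\<Sum>F\<in>\<Q> \<union> \<R>. F x) = P x" for x
      using sum.union_inter[OF \<Q>(1) \<R>(1), of "\<lambda>F. F x"]
        sum.neutral[of "\<Q> \<inter> \<R>" "\<lambda>F. F x"] inter
      by (simp add: \<Q>(6) \<R>(6) R_def)
    moreover have "P (F x) = F x" if "F \<in> \<Q> \<union> \<R>" for F x
      using that PQ[of "F x"] PR[of "F x"] \<Q>(3)[of F x] \<R>(3)[of F x] by auto
    moreover have "F (G x) = 0" if "F \<in> \<Q> \<union> \<R>" "G \<in> \<Q> \<union> \<R>" "F \<noteq> G" for F G x
      using that \<Q>(5)[of F G x] \<R>(5)[of F G x] cross(1)[of F G x] cross(2)[of G F x] by auto
    moreover have "\<exists>c. \<forall>x. A i (A j (F x)) = c *\<^sub>R F x" if "F \<in> \<Q> \<union> \<R>" for F i j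
      using that \<Q>(4)[of F i j] \<R>(4)[of F i j] by auto
    ultimately have "isotypic_family P (\<Q> \<union> \<R>)"
      unfolding isotypic_family_def using \<Q>(1,2) \<R>(1,2) by simp blast
    then show ?thesis ..
  qed
qed

end

locale linear_commuting_skew_family = commuting_skew_family q A
  for q :: "'a::euclidean_space \<Rightarrow> 'a \<Rightarrow> real" and A :: "'g::euclidean_space \<Rightarrow> 'a \<Rightarrow> 'a" +
  assumes linear_index: "linear (\<lambda>\<xi>. A \<xi> x)"
begin

text \<open>
  \<open>J\<close> is a complex structure on the range of \<open>P\<close>, extended by zero, on which the family acts through
  the weight \<open>\<alpha>\<close>. On the part where the family acts by zero, \<open>\<alpha> = 0\<close> and no complex structure need
  exist, so that \<open>J\<^sup>2 = - P\<close> is required only for \<open>\<alpha> \<noteq> 0\<close>.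
\<close>

definition weight_structure :: "('a \<Rightarrow> 'a) \<Rightarrow> 'g \<Rightarrow> ('a \<Rightarrow> 'a) \<Rightarrow> bool" where
  "weight_structure P \<alpha> J \<longleftrightarrow> linear J \<and> (\<forall>\<xi> x. A \<xi> (P x) = (\<xi> \<bullet> \<alpha>) *\<^sub>R J x) \<and>
    (\<forall>x. P (J x) = J x) \<and> (\<alpha> \<noteq> 0 \<longrightarrow> (\<forall>x. J (J x) = - P x)) \<and>
    (\<forall>L\<in>commutant A. \<forall>x. L (J x) = J (L x))"

text \<open>
  If $A_\xi P \neq 0$, skewness makes the scalar $c$ in $A_\xi A_\xi P = c P$ negative, and
  $J = A_\xi P / \sqrt{-c}$ is a complex structure. Every other $A_\eta P$ is a multiple of it, since
  $c A_\eta P = A_\xi (A_\xi A_\eta P)$ and the product in parentheses is a scalar on the range of \<open>P\<close>.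
\<close>

lemma isotypic_weight:
  assumes "natural_projection q A P" and scal: "\<And>\<xi> \<eta>. \<exists>c. \<forall>x. A \<xi> (A \<eta> (P x)) = c *\<^sub>R P x"
  shows "\<exists>\<alpha> J. weight_structure P \<alpha> J"
proof (cases "\<forall>\<xi> x. A \<xi> (P x) = 0")
  case True
  then show ?thesis
    using natural_projectionD(1)[OF assms(1)]
    by (intro exI[of _ 0] exI[of _ "\<lambda>_. 0"]) (auto simp: weight_structure_def linear_0 commutant_def linear_zero)
next
  case False
  note P = natural_projectionD[OF assms(1)]
  note bil = inner_formD(1)[OF q]
  from False obtain \<xi> x0 where x0: "A \<xi> (P x0) \<noteq> 0" by blast
  obtain c where c: "\<And>x. A \<xi> (A \<xi> (P x)) = c *\<^sub>R P x" using scal by blast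
  have "c * q (P x0) (P x0) = - q (A \<xi> (P x0)) (A \<xi> (P x0))"
    using skew[of \<xi> "A \<xi> (P x0)" "P x0"] by (simp add: c bilinear_lmul[OF bil])
  also have "\<dots> < 0" using inner_formD(3)[OF q x0] by simp
  finally have "c < 0"
    using inner_form_nonneg[OF q, of "P x0"] by (simp add: mult_less_0_iff)
  define k where "k = sqrt (- c)"
  have k: "k \<noteq> 0" "k * k = - c" using \<open>c < 0\<close> by (auto simp: k_def)
  define J where "J x = A \<xi> (P x) /\<^sub>R k" for x
  have AP: "A \<xi> (P x) = P (A \<xi> x)" for \<xi> x by (rule P(4)[OF in_commutant])
  have "\<exists>a. \<forall>x. A \<eta> (P x) = a *\<^sub>R J x" for \<eta>
  proof -
    obtain d where d: "\<And>x. A \<xi> (A \<eta> (P x)) = d *\<^sub>R P x" using scal by blast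
    have "A \<eta> (P x) = (d / c * k) *\<^sub>R J x" for x
    proof -
      have "c *\<^sub>R A \<eta> (P x) = A \<eta> (A \<xi> (A \<xi> (P x)))"
        by (simp add: c linear_scale[OF linear])
      also have "\<dots> = A \<xi> (A \<xi> (A \<eta> (P x)))" by (simp add: commute)
      also have "\<dots> = d *\<^sub>R A \<xi> (P x)" by (simp add: d linear_scale[OF linear])
      finally have "A \<eta> (P x) = (1 / c) *\<^sub>R d *\<^sub>R A \<xi> (P x)"
        using \<open>c < 0\<close> by (metis divide_self_if less_irrefl scaleR_one scaleR_scaleR times_divide_eq_left mult_1)
      then show ?thesis using k by (simp add: J_def)
    qed
    then show ?thesis by blast
  qed
  then obtain a where a: "\<And>\<eta> x. A \<eta> (P x) = a \<eta> *\<^sub>R J x" by metis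
  define \<alpha> where "\<alpha> = (\<Sum>b\<in>Basis. a b *\<^sub>R b)"
  show ?thesis
    unfolding weight_structure_def
  proof (intro exI conjI allI ballI impI)
    show "linear J"
      unfolding J_def by (rule linearI) (simp_all add: linear_add linear_scale P(1) linear scaleR_add_right)
    show "A \<eta> (P x) = (\<eta> \<bullet> \<alpha>) *\<^sub>R J x" for \<eta> x
    proof -
      have "A \<eta> (P x) = A (\<Sum>b\<in>Basis. (\<eta> \<bullet> b) *\<^sub>R b) (P x)"
        by (simp add: euclidean_representation)
      also have "\<dots> = (\<Sum>b\<in>Basis. (\<eta> \<bullet> b) *\<^sub>R A b (P x))"
        by (simp add: linear_sum[OF linear_index] linear_scale[OF linear_index])
      also have "\<dots> = (\<eta> \<bullet> \<alpha>) *\<^sub>R J x"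
        by (simp add: a \<alpha>_def inner_sum_right scaleR_sum_left mult.commute)
      finally show ?thesis .
    qed
    show "P (J x) = J x" for x by (simp add: J_def linear_scale[OF P(1)] AP P(2))
    show "J (J x) = - P x" for x
    proof -
      have "J (J x) = A \<xi> (A \<xi> (P x)) /\<^sub>R k /\<^sub>R k"
        by (simp add: J_def linear_scale[OF linear] linear_scale[OF P(1)] AP P(2))
      also have "\<dots> = (c / (k * k)) *\<^sub>R P x" by (simp add: c divide_inverse)
      finally show ?thesis using \<open>c < 0\<close> by (simp add: k(2))
    qed
    show "L (J x) = J (L x)" if "L \<in> commutant A" for L x
      using that P(4)[OF that] by (simp add: J_def commutant_def linear_scale)
  qed
qed

definition weight_system :: "('a \<Rightarrow> 'a) set \<Rightarrow> (('a \<Rightarrow> 'a) \<Rightarrow> 'g) \<Rightarrow> (('a \<Rightarrow> 'a) \<Rightarrow> 'a \<Rightarrow> 'a) \<Rightarrow> bool" where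
  "weight_system \<P> \<alpha> J \<longleftrightarrow> isotypic_family (\<lambda>x. x) \<P> \<and> (\<forall>P\<in>\<P>. weight_structure P (\<alpha> P) (J P))"

lemma weight_systemD:
  assumes "weight_system \<P> \<alpha> J"
  shows "finite \<P>" "P \<in> \<P> \<Longrightarrow> linear P" "P \<in> \<P> \<Longrightarrow> P (P x) = P x"
    "P \<in> \<P> \<Longrightarrow> Q \<in> \<P> \<Longrightarrow> P \<noteq> Q \<Longrightarrow> P (Q x) = 0" "(\<Sum>P\<in>\<P>. P x) = x"
    "P \<in> \<P> \<Longrightarrow> L \<in> commutant A \<Longrightarrow> L (P x) = P (L x)"
    "P \<in> \<P> \<Longrightarrow> linear (J P)" "P \<in> \<P> \<Longrightarrow> A \<xi> (P x) = (\<xi> \<bullet> \<alpha> P) *\<^sub>R J P x"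
    "P \<in> \<P> \<Longrightarrow> P (J P x) = J P x" "P \<in> \<P> \<Longrightarrow> \<alpha> P \<noteq> 0 \<Longrightarrow> J P (J P x) = - P x"
    "P \<in> \<P> \<Longrightarrow> L \<in> commutant A \<Longrightarrow> L (J P x) = J P (L x)"
proof -
  have fam: "isotypic_family (\<lambda>x. x) \<P>"
    and J: "\<And>P. P \<in> \<P> \<Longrightarrow> weight_structure P (\<alpha> P) (J P)"
    using assms by (auto simp: weight_system_def)
  show "finite \<P>" "P \<in> \<P> \<Longrightarrow> Q \<in> \<P> \<Longrightarrow> P \<noteq> Q \<Longrightarrow> P (Q x) = 0" "(\<Sum>P\<in>\<P>. P x) = x"
    using isotypic_familyD(1,5,6)[OF fam] by auto
  assume P: "P \<in> \<P>"
  show "linear P" "P (P x) = P x" "L \<in> commutant A \<Longrightarrow> L (P x) = P (L x)"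
    using natural_projectionD(1,2,4)[OF isotypic_familyD(2)[OF fam P]] by auto
  show "linear (J P)" "A \<xi> (P x) = (\<xi> \<bullet> \<alpha> P) *\<^sub>R J P x" "P (J P x) = J P x"
    "\<alpha> P \<noteq> 0 \<Longrightarrow> J P (J P x) = - P x" "L \<in> commutant A \<Longrightarrow> L (J P x) = J P (L x)"
    using J[OF P] unfolding weight_structure_def by auto
qed

text \<open>
  The splitting of a representation into parts on which it acts through a single weight up to sign,
  stated for the infinitesimal action.
\<close>

theorem isotypic_decomposition: "\<exists>\<P> \<alpha> J. weight_system \<P> \<alpha> J"
proof -
  have "natural_projection q A (\<lambda>x. x)"
    by (simp add: natural_projection_def linear_id[unfolded id_def])
  then obtain \<P> where \<P>: "isotypic_family (\<lambda>x. x) \<P>" using isotypic_splitting by blast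
  have "\<forall>P\<in>\<P>. \<exists>\<alpha> J. weight_structure P \<alpha> J"
    by (intro ballI isotypic_weight isotypic_familyD(2,4)[OF \<P>])
  then obtain \<alpha> J where "\<forall>P\<in>\<P>. weight_structure P (\<alpha> P) (J P)"
    by metis
  with \<P> show ?thesis unfolding weight_system_def by blast
qed

end


section \<open>One-parameter groups of linear operators\<close>

lemma blinfun_compose_has_vector_derivative:
  assumes "(f has_vector_derivative f') (at x within s)" "(g has_vector_derivative g') (at x within s)"
  shows "((\<lambda>x. f x o\<^sub>L g x) has_vector_derivative (f x o\<^sub>L g') + (f' o\<^sub>L g x)) (at x within s)"
  by (rule bounded_bilinear.has_vector_derivative[OF bounded_bilinear_blinfun_compose assms])

lemma blinfun_compose_id [simp]: "f o\<^sub>L id_blinfun = f" "id_blinfun o\<^sub>L f = f"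
  by (auto intro: blinfun_eqI)

text \<open>
  In finite dimension injectivity suffices, and a nonzero kernel vector $x$ would satisfy
  $a |x| \le \| B - a \| |x|$.
\<close>

lemma invertible_near_multiple_of_identity:
  fixes B :: "'a::euclidean_space \<Rightarrow>\<^sub>L 'a"
  assumes "norm (B - a *\<^sub>R id_blinfun) < a"
  obtains C where "B o\<^sub>L C = id_blinfun"
proof -
  have "inj (blinfun_apply B)"
    unfolding linear_injective_0[OF blinfun.bounded_linear_right[THEN bounded_linear.linear]]
  proof (intro allI impI)
    fix x assume "blinfun_apply B x = 0"
    then have "(B - a *\<^sub>R id_blinfun) x = - (a *\<^sub>R x)"
      by (simp add: blinfun.bilinear_simps)
    moreover have "norm ((B - a *\<^sub>R id_blinfun) x) \<le> norm (B - a *\<^sub>R id_blinfun) * norm x"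
      by (rule norm_blinfun)
    ultimately have "a * norm x \<le> norm (B - a *\<^sub>R id_blinfun) * norm x"
      using assms by (smt (verit) norm_ge_zero norm_minus_cancel norm_scaleR)
    then show "x = 0"
      using assms by (smt (verit) mult_less_cancel_right norm_le_zero_iff norm_ge_zero)
  qed
  then obtain C where C: "linear C" "\<And>x. blinfun_apply B (C x) = x"
    using linear_injective_isomorphism[OF blinfun.bounded_linear_right[THEN bounded_linear.linear], of B]
    by blast
  have "B o\<^sub>L Blinfun C = id_blinfun"
    using C by (intro blinfun_eqI) (simp add: bounded_linear_Blinfun_apply linear_conv_bounded_linear)
  then show ?thesis by (rule that)
qed

text \<open>
  Only continuity of the group is known, so it is smoothed first: with $B = \int_0^a F(s)\,ds$ the product
  $F(t) B = \int_t^{t+a} F(s)\,ds$ is differentiable in $t$. For small $a$ the operator $B$ is close to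
  $a$ times the identity, hence invertible, and $F(t)$ inherits differentiability.
\<close>

lemma one_parameter_group_differentiable:
  fixes F :: "real \<Rightarrow> ('a::euclidean_space \<Rightarrow>\<^sub>L 'a)"
  assumes add: "\<And>s t. F (s + t) = F s o\<^sub>L F t" and zero: "F 0 = id_blinfun"
    and cont: "continuous_on UNIV F"
  obtains A where "\<And>t. (F has_vector_derivative F t o\<^sub>L A) (at t)"
proof -
  have cont': "continuous_on S F" for S using cont continuous_on_subset by blast
  have "isCont F 0" using cont by (simp add: continuous_on_eq_continuous_at)
  then have "\<exists>d>0. \<forall>s. norm s < d \<longrightarrow> norm (F s - id_blinfun) < 1/2"
    unfolding continuous_at_eps_delta dist_norm zero diff_0_right
    by (rule allE[of _ "1/2"]) simp
  then obtain d where d: "d > 0" "\<And>s. norm s < d \<Longrightarrow> norm (F s - id_blinfun) < 1/2"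
    by blast
  define a where "a = min (d / 2) 1"
  have a: "0 < a" "a < d" "a \<le> 1" using d(1) by (auto simp: a_def)
  define B where "B = integral {0..a} F"
  have "norm (integral {0..a} (\<lambda>s. F s - id_blinfun)) \<le> 1/2 * (a - 0)"
    by (intro integral_bound continuous_on_diff cont' continuous_on_const less_imp_le[OF d(2)]) (use a in auto)
  also have "integral {0..a} (\<lambda>s. F s - id_blinfun) = B - a *\<^sub>R id_blinfun"
    using a by (simp add: B_def integral_diff integrable_continuous_real cont')
  finally have "norm (B - a *\<^sub>R id_blinfun) < a" using a by simp
  then obtain C where C: "B o\<^sub>L C = id_blinfun" by (rule invertible_near_multiple_of_identity)
  \<comment> \<open>The interval from \<open>-1\<close> to \<open>3\<close> contains a neighbourhood of \<open>0\<close> and of \<open>a \<le> 1\<close>.\<close>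
  define G where "G u = integral {-1..u} F" for u
  have G: "(G has_vector_derivative F u) (at u)" if "-1 < u" "u < 3" for u
  proof -
    have "(G has_vector_derivative F u) (at u within {-1..3})"
      unfolding G_def[abs_def] using that by (intro integral_has_vector_derivative cont') auto
    then show ?thesis using that by (simp add: at_within_Icc_at)
  qed
  have FB: "F t o\<^sub>L B = G (t + a) - G t" if "t \<in> {-1<..<1}" for t
  proof -
    have "G t + integral {t..t + a} F = G (t + a)"
      unfolding G_def using that a by (intro Henstock_Kurzweil_Integration.integral_combine integrable_continuous_real cont') auto
    moreover have "F t o\<^sub>L B = integral {0..a} (\<lambda>s. F t o\<^sub>L F s)"
      unfolding B_def
      by (rule integral_linear[OF integrable_continuous_real[OF cont'], symmetric, unfolded o_def])
         (rule bounded_bilinear.bounded_linear_right[OF bounded_bilinear_blinfun_compose])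
    moreover have "integral {0..a} (\<lambda>s. F t o\<^sub>L F s) = integral {t..t + a} F"
      using integral_shift_Icc_real[of 0 a F t]
      by (simp only: o_def add[symmetric] add_0 add.commute[of a t])
    ultimately show ?thesis by (simp add: algebra_simps)
  qed
  have FBd: "((\<lambda>t. F t o\<^sub>L B) has_vector_derivative (F a - F 0)) (at 0)"
  proof (rule has_vector_derivative_transform_within_open[where S = "{-1<..<1}"])
    have "((\<lambda>t. G (t + a)) has_vector_derivative F a) (at 0)"
    proof -
      have "((\<lambda>t. t + a) has_vector_derivative 1) (at 0)"
        by (auto intro!: derivative_eq_intros)
      moreover have "(G has_vector_derivative F a) (at (0 + a))" using G[of a] a by simp
      ultimately show ?thesis
        using vector_diff_chain_at[of "\<lambda>t. t + a" 1 0 G "F a"] by (simp add: o_def)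
    qed
    then show "((\<lambda>t. G (t + a) - G t) has_vector_derivative (F a - F 0)) (at 0)"
      by (intro has_vector_derivative_diff G) auto
  qed (use FB in auto)
  have "(F t o\<^sub>L B) o\<^sub>L C = F t" for t
  proof -
    have "(F t o\<^sub>L B) o\<^sub>L C = F t o\<^sub>L (B o\<^sub>L C)" by (rule blinfun_eqI) simp
    then show ?thesis by (simp add: C)
  qed
  then have F0: "(F has_vector_derivative (F a - F 0) o\<^sub>L C) (at 0)"
    using blinfun_compose_has_vector_derivative[OF FBd has_vector_derivative_const[of C]]
    by simp
  have "(F has_vector_derivative F t o\<^sub>L ((F a - F 0) o\<^sub>L C)) (at t)" for t
  proof -
    have "((\<lambda>u. u - t) has_vector_derivative 1) (at t)"
      by (auto intro!: derivative_eq_intros)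
    then have "((\<lambda>u. F (u - t)) has_vector_derivative (F a - F 0) o\<^sub>L C) (at t)"
      using vector_diff_chain_at[of "\<lambda>u. u - t" 1 t F] F0 by (simp add: o_def)
    from blinfun_compose_has_vector_derivative[OF has_vector_derivative_const[of "F t"] this]
    show ?thesis by (simp add: add[symmetric])
  qed
  then show ?thesis by (rule that)
qed

section \<open>The infinitesimal action of a torus\<close>

lemma torus_exp_surj:
  assumes "g \<in> carrier torus"
  obtains \<xi> where "g = torus_exp \<xi>"
proof -
  have "cis (Arg (g $ i)) = g $ i" for i
  proof -
    have "norm (g $ i) = 1" using assms by (simp add: torus_def)
    then show ?thesis using cis_Arg[of "g $ i"] by (cases "g $ i = 0") (auto simp: sgn_div_norm)
  qed
  then show ?thesis
    by (intro that[of "\<chi> i. Arg (g $ i)"]) (simp add: torus_exp_def vec_eq_iff)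
qed

lemma torus_exp_0: "torus_exp 0 = \<one>\<^bsub>torus\<^esub>"
  by (simp add: torus_exp_def torus_def vec_eq_iff)

lemma torus_exp_period: "torus_exp ((2 * pi) *\<^sub>R axis i 1) = \<one>\<^bsub>torus\<^esub>"
  by (simp add: torus_exp_def torus_def vec_eq_iff axis_def)

lemma continuous_on_torus_exp: "continuous_on S torus_exp"
  unfolding torus_exp_def by (intro continuous_intros)

locale torus_rep =
  fixes \<phi> :: "complex ^ 'n::finite \<Rightarrow> real ^ 'm::finite \<Rightarrow> real ^ 'm"
  assumes action: "linear_torus_action \<phi>"
begin

lemma group_action: "group_action torus UNIV \<phi>"
  using action by (simp add: linear_torus_action_def)

lemma linear: "g \<in> carrier torus \<Longrightarrow> linear (\<phi> g)"
  using action by (simp add: linear_torus_action_def)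

lemma action_mult:
  "g \<in> carrier torus \<Longrightarrow> h \<in> carrier torus \<Longrightarrow> \<phi> (g \<otimes>\<^bsub>torus\<^esub> h) x = \<phi> g (\<phi> h x)"
  using group_action.composition_rule[OF group_action] by simp

lemma action_one: "\<phi> \<one>\<^bsub>torus\<^esub> x = x"
  using group_action.id_eq_one[OF group_action] by (metis UNIV_I restrict_apply')

definition flow :: "real ^ 'n \<Rightarrow> (real ^ 'm) \<Rightarrow>\<^sub>L (real ^ 'm)" where
  "flow \<xi> = Blinfun (\<phi> (torus_exp \<xi>))"

lemma flow: "blinfun_apply (flow \<xi>) x = \<phi> (torus_exp \<xi>) x"
  using linear[OF torus_exp_closed]
  by (simp add: flow_def bounded_linear_Blinfun_apply linear_conv_bounded_linear)

lemma flow_add: "flow (\<xi> + \<eta>) = flow \<xi> o\<^sub>L flow \<eta>"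
  by (rule blinfun_eqI) (simp add: flow torus_exp_add action_mult torus_exp_closed)

lemma flow_0: "flow 0 = id_blinfun"
  by (rule blinfun_eqI) (simp add: flow torus_exp_0 action_one)

lemma flow_period: "flow ((2 * pi) *\<^sub>R axis i 1) = id_blinfun"
  by (rule blinfun_eqI) (simp add: flow torus_exp_period action_one)

lemma continuous_on_flow: "continuous_on S flow"
proof (rule continuous_on_blinfun_componentwise)
  fix b :: "real ^ 'm"
  have "continuous_on (carrier torus \<times> UNIV) (\<lambda>(g, x). \<phi> g x)"
    using action by (simp add: linear_torus_action_def)
  moreover have "continuous_on S (\<lambda>\<xi>. (torus_exp \<xi>, b))"
    by (intro continuous_on_Pair continuous_on_torus_exp continuous_on_const)
  ultimately have "continuous_on S (\<lambda>\<xi>. case (torus_exp \<xi>, b) of (g, x) \<Rightarrow> \<phi> g x)"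
    by (rule continuous_on_compose2) (auto simp: torus_exp_closed)
  then show "continuous_on S (\<lambda>\<xi>. blinfun_apply (flow \<xi>) b)"
    by (simp add: flow)
qed

definition gen :: "real ^ 'n \<Rightarrow> (real ^ 'm) \<Rightarrow>\<^sub>L (real ^ 'm)" where
  "gen \<xi> = vector_derivative (\<lambda>t. flow (t *\<^sub>R \<xi>)) (at 0)"

lemma flow_has_vector_derivative:
  "((\<lambda>t. flow (t *\<^sub>R \<xi>)) has_vector_derivative flow (t *\<^sub>R \<xi>) o\<^sub>L gen \<xi>) (at t)"
proof -
  obtain A where A: "\<And>t. ((\<lambda>t. flow (t *\<^sub>R \<xi>)) has_vector_derivative flow (t *\<^sub>R \<xi>) o\<^sub>L A) (at t)"
  proof (rule one_parameter_group_differentiable)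
    show "continuous_on UNIV (\<lambda>t. flow (t *\<^sub>R \<xi>))"
      by (rule continuous_on_compose2[OF continuous_on_flow[of UNIV]]) (auto intro: continuous_intros)
  qed (auto simp: scaleR_add_left flow_add flow_0)
  have "gen \<xi> = A"
    unfolding gen_def using vector_derivative_at[OF A[of 0]] by (simp add: flow_0)
  then show ?thesis using A by simp
qed

lemma flow_has_vector_derivative_0:
  "((\<lambda>t. flow (t *\<^sub>R \<xi>)) has_vector_derivative gen \<xi>) (at 0)"
  using flow_has_vector_derivative[of \<xi> 0] by (simp add: flow_0)

lemma flow_gen_commute: "flow \<eta> o\<^sub>L gen \<xi> = gen \<xi> o\<^sub>L flow \<eta>"
proof (rule vector_derivative_unique_at)
  show "((\<lambda>t. flow \<eta> o\<^sub>L flow (t *\<^sub>R \<xi>)) has_vector_derivative flow \<eta> o\<^sub>L gen \<xi>) (at 0)"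
    using blinfun_compose_has_vector_derivative[OF has_vector_derivative_const[of "flow \<eta>"] flow_has_vector_derivative_0]
    by simp
  have "((\<lambda>t. flow (t *\<^sub>R \<xi>) o\<^sub>L flow \<eta>) has_vector_derivative gen \<xi> o\<^sub>L flow \<eta>) (at 0)"
    using blinfun_compose_has_vector_derivative[OF flow_has_vector_derivative_0 has_vector_derivative_const[of "flow \<eta>"]]
    by simp
  then show "((\<lambda>t. flow \<eta> o\<^sub>L flow (t *\<^sub>R \<xi>)) has_vector_derivative gen \<xi> o\<^sub>L flow \<eta>) (at 0)"
    by (simp add: flow_add[symmetric] add.commute)
qed

lemma gen_commute: "gen \<eta> o\<^sub>L gen \<xi> = gen \<xi> o\<^sub>L gen \<eta>"
proof (rule vector_derivative_unique_at)
  show "((\<lambda>t. flow (t *\<^sub>R \<eta>) o\<^sub>L gen \<xi>) has_vector_derivative gen \<eta> o\<^sub>L gen \<xi>) (at 0)"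
    using blinfun_compose_has_vector_derivative[OF flow_has_vector_derivative_0 has_vector_derivative_const[of "gen \<xi>"]]
    by simp
  have "((\<lambda>t. gen \<xi> o\<^sub>L flow (t *\<^sub>R \<eta>)) has_vector_derivative gen \<xi> o\<^sub>L gen \<eta>) (at 0)"
    using blinfun_compose_has_vector_derivative[OF has_vector_derivative_const[of "gen \<xi>"] flow_has_vector_derivative_0]
    by simp
  then show "((\<lambda>t. flow (t *\<^sub>R \<eta>) o\<^sub>L gen \<xi>) has_vector_derivative gen \<xi> o\<^sub>L gen \<eta>) (at 0)"
    by (simp add: flow_gen_commute)
qed

lemma gen_add: "gen (\<xi> + \<eta>) = gen \<xi> + gen \<eta>"
proof (rule vector_derivative_unique_at)
  show "((\<lambda>t. flow (t *\<^sub>R (\<xi> + \<eta>))) has_vector_derivative gen (\<xi> + \<eta>)) (at 0)"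
    by (rule flow_has_vector_derivative_0)
  show "((\<lambda>t. flow (t *\<^sub>R (\<xi> + \<eta>))) has_vector_derivative gen \<xi> + gen \<eta>) (at 0)"
    using blinfun_compose_has_vector_derivative[OF flow_has_vector_derivative_0[of \<xi>] flow_has_vector_derivative_0[of \<eta>]]
    by (simp add: scaleR_add_right flow_add[symmetric] flow_0 add.commute)
qed

lemma gen_scaleR: "gen (c *\<^sub>R \<xi>) = c *\<^sub>R gen \<xi>"
proof (rule vector_derivative_unique_at)
  show "((\<lambda>t. flow (t *\<^sub>R (c *\<^sub>R \<xi>))) has_vector_derivative gen (c *\<^sub>R \<xi>)) (at 0)"
    by (rule flow_has_vector_derivative_0)
  have "((\<lambda>t. t * c) has_vector_derivative c) (at 0)"
    by (auto intro!: derivative_eq_intros simp: has_real_derivative_iff_has_vector_derivative[symmetric])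
  from vector_diff_chain_at[OF this, of "\<lambda>t. flow (t *\<^sub>R \<xi>)" "gen \<xi>"]
  show "((\<lambda>t. flow (t *\<^sub>R (c *\<^sub>R \<xi>))) has_vector_derivative c *\<^sub>R gen \<xi>) (at 0)"
    using flow_has_vector_derivative_0[of \<xi>] by (simp add: o_def)
qed

lemma linear_gen: "linear (\<lambda>\<xi>. blinfun_apply (gen \<xi>) x)"
  by (rule linearI) (simp_all add: gen_add gen_scaleR blinfun.bilinear_simps)

lemma orbit_has_vector_derivative:
  "((\<lambda>t. blinfun_apply (flow (t *\<^sub>R \<xi>)) x) has_vector_derivative flow (t *\<^sub>R \<xi>) (gen \<xi> x)) (at t within S)"
  using bounded_linear.has_vector_derivative[OF blinfun.bounded_linear_left has_vector_derivative_at_within[OF flow_has_vector_derivative]]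
  by simp

lemma generated_field_eq: "generated_field \<phi> \<xi> x = gen \<xi> x"
  unfolding generated_field_def flow[symmetric]
  using vector_derivative_at[OF orbit_has_vector_derivative[of \<xi> x 0]] by (simp add: flow_0)

lemma flow_fixes_kernel:
  assumes "gen \<xi> x = 0"
  shows "flow (t *\<^sub>R \<xi>) x = x"
proof -
  have "((\<lambda>t. blinfun_apply (flow (t *\<^sub>R \<xi>)) x) has_derivative (\<lambda>h. 0)) (at t within UNIV)" for t
    using orbit_has_vector_derivative[of \<xi> x t UNIV] assms by (simp add: has_vector_derivative_def)
  from has_derivative_zero_constant[OF convex_UNIV this]
  have "blinfun_apply (flow (t *\<^sub>R \<xi>)) x = blinfun_apply (flow (0 *\<^sub>R \<xi>)) x"
    by (metis UNIV_I)
  then show ?thesis by (simp add: flow_0)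
qed

lemma action_in_commutant:
  assumes "g \<in> carrier torus"
  shows "\<phi> g \<in> commutant (\<lambda>\<xi>. blinfun_apply (gen \<xi>))"
proof -
  obtain \<eta> where "g = torus_exp \<eta>" using torus_exp_surj[OF assms] .
  moreover have "flow \<eta> (gen \<xi> x) = gen \<xi> (flow \<eta> x)" for \<xi> x
    using flow_gen_commute[of \<eta> \<xi>] by (metis blinfun_apply_blinfun_compose)
  ultimately show ?thesis using linear[OF assms] by (simp add: commutant_def flow)
qed

lemma inner_form_flow_has_derivative:
  assumes "bounded_bilinear q"
  shows "((\<lambda>t. q (flow (t *\<^sub>R \<xi>) x) (flow (t *\<^sub>R \<xi>) y)) has_vector_derivative
    (q (flow (t *\<^sub>R \<xi>) (gen \<xi> x)) (flow (t *\<^sub>R \<xi>) y) + q (flow (t *\<^sub>R \<xi>) x) (flow (t *\<^sub>R \<xi>) (gen \<xi> y)))) (at t within S)"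
  using bounded_bilinear.has_vector_derivative[OF assms orbit_has_vector_derivative orbit_has_vector_derivative]
  by (simp add: add.commute)

text \<open>
  Averaging over the circle generated by \<open>e\<close>. The derivative of $q(F_t x, F_t y)$ integrates to zero over
  a full period, which is the skewness of \<open>gen e\<close> for the average; generators that are already skew stay
  so because they commute with the circle.
\<close>

lemma average_inner_form:
  fixes q :: "real ^ 'm \<Rightarrow> real ^ 'm \<Rightarrow> real"
  assumes q: "inner_form q" and e: "flow ((2 * pi) *\<^sub>R e) = id_blinfun"
  defines "q' \<equiv> \<lambda>x y. integral {0..2 * pi} (\<lambda>t. q (flow (t *\<^sub>R e) x) (flow (t *\<^sub>R e) y))"
  shows "inner_form q'" "q' (gen e x) y = - q' x (gen e y)"
    "(\<And>x y. q (gen \<xi> x) y = - q x (gen \<xi> y)) \<Longrightarrow> q' (gen \<xi> x) y = - q' x (gen \<xi> y)"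
proof -
  note bil = inner_formD(1)[OF q]
  have bb: "bounded_bilinear q" using bil by (simp add: bilinear_conv_bounded_bilinear)
  have orb: "continuous_on S (\<lambda>t. blinfun_apply (flow (t *\<^sub>R e)) x)" for S x
    using orbit_has_vector_derivative has_vector_derivative_continuous
    by (metis continuous_at_imp_continuous_on)
  have cont: "continuous_on S (\<lambda>t. q (flow (t *\<^sub>R e) x) (flow (t *\<^sub>R e) y))" for S x y
    by (rule inner_form_continuous[OF q orb orb])
  have int: "(\<lambda>t. q (flow (t *\<^sub>R e) x) (flow (t *\<^sub>R e) y)) integrable_on {0..2 * pi}" for x y
    by (rule integrable_continuous_real[OF cont])
  show "inner_form q'"
    unfolding inner_form_def
  proof (intro conjI allI impI)
    show "bilinear q'"
      unfolding bilinear_def q'_def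
      by (auto intro!: linearI simp: blinfun.bilinear_simps bilinear_ladd[OF bil] bilinear_radd[OF bil]
          bilinear_lmul[OF bil] bilinear_rmul[OF bil] integral_add int)
    show "q' x y = q' y x" for x y
      unfolding q'_def by (subst inner_formD(2)[OF q]) (rule refl)
    fix x :: "real ^ 'm" assume "x \<noteq> 0"
    have "q' x x \<ge> 0"
      unfolding q'_def by (intro integral_nonneg int inner_form_nonneg[OF q])
    moreover have "q' x x \<noteq> 0"
    proof
      assume "q' x x = 0"
      then have "\<forall>t\<in>{0..2 * pi}. q (flow (t *\<^sub>R e) x) (flow (t *\<^sub>R e) x) = 0"
        unfolding q'_def by (subst (asm) integral_eq_0_iff[OF cont]) (simp_all add: inner_form_nonneg[OF q])
      then have "q (flow (0 *\<^sub>R e) x) (flow (0 *\<^sub>R e) x) = 0" by (rule bspec) simp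
      then show False using inner_form_eq_0[OF q] \<open>x \<noteq> 0\<close> by (simp add: flow_0)
    qed
    ultimately show "q' x x > 0" by simp
  qed
  have "((\<lambda>t. q (flow (t *\<^sub>R e) (gen e x)) (flow (t *\<^sub>R e) y) + q (flow (t *\<^sub>R e) x) (flow (t *\<^sub>R e) (gen e y)))
      has_integral q (flow ((2 * pi) *\<^sub>R e) x) (flow ((2 * pi) *\<^sub>R e) y) - q (flow (0 *\<^sub>R e) x) (flow (0 *\<^sub>R e) y))
      {0..2 * pi}"
    by (rule fundamental_theorem_of_calculus[OF _ inner_form_flow_has_derivative[OF bb]]) simp
  then have "((\<lambda>t. q (flow (t *\<^sub>R e) (gen e x)) (flow (t *\<^sub>R e) y) + q (flow (t *\<^sub>R e) x) (flow (t *\<^sub>R e) (gen e y)))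
      has_integral 0) {0..2 * pi}"
    by (simp add: e flow_0)
  then have "q' (gen e x) y + q' x (gen e y) = 0"
    unfolding q'_def integral_add[OF int int, symmetric] by (rule integral_unique)
  then show "q' (gen e x) y = - q' x (gen e y)" by simp
  assume *: "\<And>x y. q (gen \<xi> x) y = - q x (gen \<xi> y)"
  have "flow \<eta> (gen \<xi> x) = gen \<xi> (flow \<eta> x)" for \<eta> x
    using flow_gen_commute[of \<eta> \<xi>] by (metis blinfun_apply_blinfun_compose)
  then show "q' (gen \<xi> x) y = - q' x (gen \<xi> y)"
    unfolding q'_def by (simp add: *)
qed

text \<open>
  Averaging over the coordinate circles one after another requires only integrals in one variable.
\<close>

lemma invariant_inner_form:
  obtains q where "inner_form q" "\<And>\<xi> x y. q (gen \<xi> x) y = - q x (gen \<xi> y)"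
proof -
  have ex: "\<exists>q. inner_form q \<and> (\<forall>i\<in>I. \<forall>x y. q (gen (axis i 1) x) y = - q x (gen (axis i 1) y))" for I :: "'n set"
    using finite[of I]
  proof (induction I rule: finite_induct)
    case empty
    have "inner_form ((\<bullet>) :: real ^ 'm \<Rightarrow> _)"
      by (auto simp: inner_form_def bilinear_def inner_commute inner_add_left inner_add_right intro!: linearI)
    then show ?case by auto
  next
    case (insert i I)
    then obtain q where q: "inner_form q" "\<And>j x y. j \<in> I \<Longrightarrow> q (gen (axis j 1) x) y = - q x (gen (axis j 1) y)"
      by blast
    show ?case
      using average_inner_form[OF q(1) flow_period[of i]] q(2) by (intro exI conjI ballI allI) auto
  qed
  obtain q where q: "inner_form q" "\<And>i x y. q (gen (axis i 1) x) y = - q x (gen (axis i 1) y)"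
    using ex[of UNIV] by auto
  note bil = inner_formD(1)[OF q(1)]
  have "q (gen \<xi> x) y = - q x (gen \<xi> y)" for \<xi> x y
  proof -
    have "linear (\<lambda>\<xi>. q (gen \<xi> x) y)" "linear (\<lambda>\<xi>. - q x (gen \<xi> y))"
      by (auto intro!: linearI simp: gen_add gen_scaleR blinfun.bilinear_simps bilinear_ladd[OF bil] bilinear_radd[OF bil]
          bilinear_lmul[OF bil] bilinear_rmul[OF bil])
    then have "(\<lambda>\<xi>. q (gen \<xi> x) y) = (\<lambda>\<xi>. - q x (gen \<xi> y))"
      by (rule linear_eq_stdbasis) (auto simp: Basis_vec_def q(2))
    then show ?thesis by meson
  qed
  with q(1) show ?thesis by (rule that)
qed

lemma inner_form_action_invariant:
  assumes q: "inner_form q" "\<And>\<xi> x y. q (gen \<xi> x) y = - q x (gen \<xi> y)" and "g \<in> carrier torus"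
  shows "q (\<phi> g x) (\<phi> g y) = q x y"
proof -
  obtain \<xi> where g: "g = torus_exp \<xi>" using torus_exp_surj[OF assms(3)] .
  have bb: "bounded_bilinear q" using inner_formD(1)[OF q(1)] by (simp add: bilinear_conv_bounded_bilinear)
  have comm: "flow \<eta> (gen \<xi> x) = gen \<xi> (flow \<eta> x)" for \<eta> x
    using flow_gen_commute[of \<eta> \<xi>] by (metis blinfun_apply_blinfun_compose)
  have "((\<lambda>t. q (flow (t *\<^sub>R \<xi>) x) (flow (t *\<^sub>R \<xi>) y)) has_derivative (\<lambda>h. 0)) (at t within UNIV)" for t
    using inner_form_flow_has_derivative[OF bb, of \<xi> x y t UNIV]
    by (simp add: has_vector_derivative_def comm q(2))
  from has_derivative_zero_constant[OF convex_UNIV this]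
  have "q (flow (1 *\<^sub>R \<xi>) x) (flow (1 *\<^sub>R \<xi>) y) = q (flow (0 *\<^sub>R \<xi>) x) (flow (0 *\<^sub>R \<xi>) y)"
    by (metis UNIV_I)
  then show ?thesis by (simp add: flow_0 g flow)
qed

end


section \<open>Splitting functions along the isotypic projections\<close>

lemma in_span_if_orthogonal:
  fixes v :: "'a::euclidean_space"
  assumes "\<And>\<xi>. (\<And>a. a \<in> S \<Longrightarrow> \<xi> \<bullet> a = 0) \<Longrightarrow> \<xi> \<bullet> v = 0"
  shows "v \<in> span S"
proof -
  obtain y z where yz: "y \<in> span S" "\<And>w. w \<in> span S \<Longrightarrow> orthogonal z w" "v = y + z"
    using orthogonal_subspace_decomp_exists[of S v] by blast
  have "z \<bullet> v = 0"
    using yz(2) by (intro assms) (auto simp: orthogonal_def span_base)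
  moreover have "z \<bullet> y = 0" using yz(1,2) by (auto simp: orthogonal_def)
  ultimately have "z = 0" using yz(3) by (simp add: inner_add_right)
  with yz show ?thesis by simp
qed

text \<open>
  Coefficients with respect to a possibly dependent spanning family that depend linearly on the
  vector, each given by the inner product with a fixed vector.
\<close>

lemma linear_coordinates_on_span:
  fixes \<alpha> :: "'i \<Rightarrow> 'a::euclidean_space"
  assumes "finite I"
  shows "\<exists>d. \<forall>v\<in>span (\<alpha> ` I). v = (\<Sum>i\<in>I. (v \<bullet> d i) *\<^sub>R \<alpha> i)"
  using assms
proof (induction I rule: finite_induct)
  case empty
  then show ?case by simp
next
  case (insert s I)
  then obtain d where d: "\<And>v. v \<in> span (\<alpha> ` I) \<Longrightarrow> v = (\<Sum>i\<in>I. (v \<bullet> d i) *\<^sub>R \<alpha> i)" by blast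
  show ?case
  proof (cases "\<alpha> s \<in> span (\<alpha> ` I)")
    case True
    have "v = (\<Sum>i\<in>insert s I. (v \<bullet> (d(s := 0)) i) *\<^sub>R \<alpha> i)" if "v \<in> span (\<alpha> ` insert s I)" for v
    proof -
      have "v \<in> span (\<alpha> ` I)" using that True by (simp add: span_redundant)
      moreover have "(\<Sum>i\<in>I. (v \<bullet> (d(s := 0)) i) *\<^sub>R \<alpha> i) = (\<Sum>i\<in>I. (v \<bullet> d i) *\<^sub>R \<alpha> i)"
        using insert.hyps by (intro sum.cong) auto
      ultimately show ?thesis using d insert.hyps by simp
    qed
    then show ?thesis by blast
  next
    case False
    obtain y z where yz: "y \<in> span (\<alpha> ` I)" "\<And>w. w \<in> span (\<alpha> ` I) \<Longrightarrow> orthogonal z w" "\<alpha> s = y + z"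
      using orthogonal_subspace_decomp_exists[of "\<alpha> ` I" "\<alpha> s"] by blast
    have "z \<noteq> 0" using False yz by auto
    \<comment> \<open>The functional that is \<open>1\<close> on \<open>\<alpha> s\<close> and vanishes on the span of the other vectors.\<close>
    define l where "l = z /\<^sub>R (z \<bullet> z)"
    have lw: "w \<bullet> l = 0" if "w \<in> span (\<alpha> ` I)" for w
      using yz(2)[OF that] by (simp add: l_def orthogonal_def inner_commute)
    have ls: "\<alpha> s \<bullet> l = 1"
    proof -
      have "\<alpha> s \<bullet> l = z \<bullet> l" using lw[OF yz(1)] yz(3) by (simp add: inner_add_left)
      then show ?thesis using \<open>z \<noteq> 0\<close> by (simp add: l_def)
    qed
    define d' where "d' i = (if i = s then l else d i - (\<alpha> s \<bullet> d i) *\<^sub>R l)" for i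
    have "v = (\<Sum>i\<in>insert s I. (v \<bullet> d' i) *\<^sub>R \<alpha> i)" if v: "v \<in> span (\<alpha> ` insert s I)" for v
    proof -
      obtain k where k: "v - k *\<^sub>R \<alpha> s \<in> span (\<alpha> ` I)"
        using v[unfolded image_insert span_breakdown_eq] by blast
      have vl: "v \<bullet> l = k" using lw[OF k] by (simp add: inner_diff_left ls)
      have "v - k *\<^sub>R \<alpha> s = (\<Sum>i\<in>I. ((v - k *\<^sub>R \<alpha> s) \<bullet> d i) *\<^sub>R \<alpha> i)"
        by (rule d[OF k])
      also have "\<dots> = (\<Sum>i\<in>I. (v \<bullet> d' i) *\<^sub>R \<alpha> i)"
        using insert.hyps
        by (intro sum.cong) (auto simp: d'_def inner_diff_left inner_diff_right vl mult.commute)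
      finally show ?thesis
        using insert.hyps by (simp add: d'_def vl algebra_simps)
    qed
    then show ?thesis by blast
  qed
qed

text \<open>
  The setting near the origin: \<open>\<G>\<close> is the set of operators of the group, and \<open>V\<close> may be shrunk
  towards the origin in each component separately.
\<close>

locale projection_family =
  fixes \<P> :: "('a::euclidean_space \<Rightarrow> 'a) set" and \<G> :: "('a \<Rightarrow> 'a) set" and V :: "'a set"
  assumes finite: "finite \<P>"
    and linear: "P \<in> \<P> \<Longrightarrow> linear P" and idem: "P \<in> \<P> \<Longrightarrow> P (P x) = P x"
    and orth: "P \<in> \<P> \<Longrightarrow> Q \<in> \<P> \<Longrightarrow> P \<noteq> Q \<Longrightarrow> P (Q x) = 0"
    and equivariant: "P \<in> \<P> \<Longrightarrow> g \<in> \<G> \<Longrightarrow> g (P x) = P (g x)"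
    and linear_group: "g \<in> \<G> \<Longrightarrow> linear g"
    and V: "open V" "g \<in> \<G> \<Longrightarrow> x \<in> V \<Longrightarrow> g x \<in> V"
    and segment: "P \<in> \<P> \<Longrightarrow> x \<in> V \<Longrightarrow> s \<in> {0..1} \<Longrightarrow> x - s *\<^sub>R P x \<in> V"
begin

lemma project_out: "P \<in> \<P> \<Longrightarrow> x \<in> V \<Longrightarrow> x - P x \<in> V"
  using segment[of P x 1] by simp

lemma smooth_on_project_out:
  assumes "P \<in> \<P>" "smooth_on V f"
  shows "smooth_on V (\<lambda>x. f (x - P x))"
proof (rule smooth_on_compose_bounded_linear[OF V(1) assms(2) _ V(1)])
  show "bounded_linear (\<lambda>x. x - P x)"
    using linear[OF assms(1)] by (simp add: linear_conv_bounded_linear bounded_linear_sub bounded_linear_ident)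
qed (use project_out[OF assms(1)] in auto)

text \<open>
  The coefficient of each projection vanishes together with the component along it, which is what
  Hadamard's formula needs to turn it into a one-form.
\<close>

definition weight_coefficients ::
    "('a \<Rightarrow> 'a) set \<Rightarrow> (('a \<Rightarrow> 'a) \<Rightarrow> 'b::euclidean_space) \<Rightarrow> ('a \<Rightarrow> 'b) \<Rightarrow>
     (('a \<Rightarrow> 'a) \<Rightarrow> 'a \<Rightarrow> real) \<Rightarrow> bool" where
  "weight_coefficients I \<alpha> \<Phi> f \<longleftrightarrow>
     (\<forall>P\<in>I. smooth_on V (f P) \<and> (\<forall>g\<in>\<G>. \<forall>x\<in>V. f P (g x) = f P x) \<and>
        (\<forall>x\<in>V. P x = 0 \<longrightarrow> f P x = 0)) \<and>
     (\<forall>x\<in>V. \<Phi> x = (\<Sum>P\<in>I. f P x *\<^sub>R \<alpha> P))"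

lemma weight_coefficientsD:
  assumes "weight_coefficients I \<alpha> \<Phi> f"
  shows "P \<in> I \<Longrightarrow> smooth_on V (f P)" "P \<in> I \<Longrightarrow> g \<in> \<G> \<Longrightarrow> x \<in> V \<Longrightarrow> f P (g x) = f P x"
    "P \<in> I \<Longrightarrow> x \<in> V \<Longrightarrow> P x = 0 \<Longrightarrow> f P x = 0"
    "x \<in> V \<Longrightarrow> \<Phi> x = (\<Sum>P\<in>I. f P x *\<^sub>R \<alpha> P)"
  using assms by (auto simp: weight_coefficients_def)

text \<open>
  The induction moves the projections one at a time from \<open>S\<close>, where the weight may be used only at
  points with \<open>P x \<noteq> 0\<close>, to \<open>J\<close>, where it may always be used but the function has to vanish when
  \<open>P x = 0\<close>. For \<open>s\<close> in \<open>S\<close>, the function $\Phi(x - s x)$ does not involve the weight of \<open>s\<close>, and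
  $\Phi(x) - \Phi(x - s x)$ vanishes when $s x = 0$. When \<open>S\<close> is empty the span is fixed and the
  coefficients are inner products with fixed vectors.
\<close>

lemma partial_weight_decomposition:
  fixes \<Phi> :: "'a \<Rightarrow> 'b::euclidean_space" and \<alpha> :: "('a \<Rightarrow> 'a) \<Rightarrow> 'b"
  assumes "S \<inter> J = {}" "S \<union> J \<subseteq> \<P>" "smooth_on V \<Phi>"
    and "\<And>g x. g \<in> \<G> \<Longrightarrow> x \<in> V \<Longrightarrow> \<Phi> (g x) = \<Phi> x"
    and "\<And>x. x \<in> V \<Longrightarrow> \<Phi> x \<in> span (\<alpha> ` (J \<union> {P \<in> S. P x \<noteq> 0}))"
    and "\<And>P x. P \<in> J \<Longrightarrow> x \<in> V \<Longrightarrow> P x = 0 \<Longrightarrow> \<Phi> x = 0"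
  shows "\<exists>f. weight_coefficients (S \<union> J) \<alpha> \<Phi> f"
proof -
  have "finite S" using assms(2) by (auto intro: finite_subset[OF _ finite])
  then show ?thesis using assms
  proof (induction S arbitrary: J \<Phi> rule: finite_induct)
    case empty
    have "finite J" using empty.prems(2) by (auto intro: finite_subset[OF _ finite])
    from linear_coordinates_on_span[OF this, of \<alpha>] obtain d where
      d: "\<And>v. v \<in> span (\<alpha> ` J) \<Longrightarrow> v = (\<Sum>P\<in>J. (v \<bullet> d P) *\<^sub>R \<alpha> P)" by blast
    have "smooth_on V (\<lambda>x. \<Phi> x \<bullet> d P)" for P
      by (rule smooth_on_bounded_linear[OF V(1) empty.prems(3) bounded_linear_inner_left])
    then show ?case
      using d empty.prems by (intro exI[of _ "\<lambda>P x. \<Phi> x \<bullet> d P"]) (auto simp: weight_coefficients_def)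
  next
    case (insert s S)
    have s: "s \<in> \<P>" using insert.prems(2) by auto
    have proj: "P (x - s x) = (if P = s then 0 else P x)" if "P \<in> \<P>" for P x
      using that s by (simp add: linear_diff linear idem orth)
    define \<Phi>' where "\<Phi>' x = \<Phi> (x - s x)" for x
    have inv': "\<Phi>' (g x) = \<Phi>' x" if "g \<in> \<G>" "x \<in> V" for g x
    proof -
      have "g x - s (g x) = g (x - s x)"
        using that s by (simp add: linear_diff linear_group equivariant[OF s that(1)])
      then show ?thesis
        using insert.prems(4)[OF that(1) project_out[OF s that(2)]] by (simp add: \<Phi>'_def)
    qed
    have smooth': "smooth_on V \<Phi>'"
      unfolding \<Phi>'_def by (rule smooth_on_project_out[OF s insert.prems(3)])
    have span': "\<Phi>' x \<in> span (\<alpha> ` (J \<union> {P \<in> S. P x \<noteq> 0}))" if "x \<in> V" for x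
    proof -
      have "J \<union> {P \<in> insert s S. P (x - s x) \<noteq> 0} \<subseteq> J \<union> {P \<in> S. P x \<noteq> 0}"
        using insert.prems(2) by (auto simp: proj split: if_splits)
      then show ?thesis
        unfolding \<Phi>'_def using insert.prems(5)[OF project_out[OF s that]] span_mono image_mono
        by (meson subsetD)
    qed
    have van': "\<Phi>' x = 0" if "P \<in> J" "x \<in> V" "P x = 0" for P x
      unfolding \<Phi>'_def using that insert.prems(1,2)
      by (intro insert.prems(6)[OF that(1) project_out[OF s that(2)]]) (auto simp: proj)
    have "\<exists>f. weight_coefficients (S \<union> J) \<alpha> \<Phi>' f"
      using insert.prems(1,2) smooth' inv' span' van' by (intro insert.IH) auto
    then obtain f1 where "weight_coefficients (S \<union> J) \<alpha> \<Phi>' f1" ..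
    note f1 = weight_coefficientsD[OF this]
    have "\<exists>f. weight_coefficients (S \<union> insert s J) \<alpha> (\<lambda>x. \<Phi> x - \<Phi>' x) f"
    proof (rule insert.IH)
      show "S \<inter> insert s J = {}" "S \<union> insert s J \<subseteq> \<P>"
        using insert.prems(1,2) insert.hyps by auto
      show "smooth_on V (\<lambda>x. \<Phi> x - \<Phi>' x)"
        by (rule smooth_on_diff[OF V(1) insert.prems(3) smooth'])
      show "\<Phi> (g x) - \<Phi>' (g x) = \<Phi> x - \<Phi>' x" if "g \<in> \<G>" "x \<in> V" for g x
        using inv'[OF that] insert.prems(4)[OF that] by simp
      show "\<Phi> x - \<Phi>' x \<in> span (\<alpha> ` (insert s J \<union> {P \<in> S. P x \<noteq> 0}))" if "x \<in> V" for x
      proof (rule span_diff)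
        show "\<Phi> x \<in> span (\<alpha> ` (insert s J \<union> {P \<in> S. P x \<noteq> 0}))"
          by (rule subsetD[OF span_mono insert.prems(5)[OF that]]) auto
        show "\<Phi>' x \<in> span (\<alpha> ` (insert s J \<union> {P \<in> S. P x \<noteq> 0}))"
          by (rule subsetD[OF span_mono span'[OF that]]) auto
      qed
      show "\<Phi> x - \<Phi>' x = 0" if "P \<in> insert s J" "x \<in> V" "P x = 0" for P x
      proof (cases "P = s")
        case True
        then show ?thesis using that by (simp add: \<Phi>'_def)
      next
        case False
        then show ?thesis using that van'[of P x] insert.prems(6)[of P x] by simp
      qed
    qed
    then obtain f2 where "weight_coefficients (S \<union> insert s J) \<alpha> (\<lambda>x. \<Phi> x - \<Phi>' x) f2" ..
    note f2 = weight_coefficientsD[OF this]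
    have sSJ: "s \<notin> S \<union> J" using insert.hyps insert.prems(1) by auto
    have fin: "finite (S \<union> J)" using insert.prems(2) by (auto intro: finite_subset[OF _ finite])
    define f where "f P x = (if P = s then f2 s x else f1 P x + f2 P x)" for P x
    show ?case
      unfolding weight_coefficients_def
    proof (intro exI[of _ f] conjI ballI impI)
      fix P assume P: "P \<in> insert s S \<union> J"
      show "smooth_on V (f P)"
        unfolding f_def[abs_def] using P f1(1) f2(1) by (cases "P = s") (auto intro!: smooth_on_add V(1))
      show "f P (g x) = f P x" if "g \<in> \<G>" "x \<in> V" for g x
        using P that f1(2)[of P g x] f2(2)[of P g x] by (auto simp: f_def)
      show "f P x = 0" if "x \<in> V" "P x = 0" for x
        using P that f1(3)[of P x] f2(3)[of P x] by (auto simp: f_def)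
    next
      fix x assume x: "x \<in> V"
      have "\<Phi> x = (\<Sum>P\<in>S \<union> J. f1 P x *\<^sub>R \<alpha> P) + (\<Sum>P\<in>insert s (S \<union> J). f2 P x *\<^sub>R \<alpha> P)"
        using f1(4)[OF x] f2(4)[OF x] by (simp add: algebra_simps)
      also have "\<dots> = f2 s x *\<^sub>R \<alpha> s + (\<Sum>P\<in>S \<union> J. (f1 P x + f2 P x) *\<^sub>R \<alpha> P)"
        using sSJ fin by (simp add: sum.distrib scaleR_add_left)
      also have "(\<Sum>P\<in>S \<union> J. (f1 P x + f2 P x) *\<^sub>R \<alpha> P) = (\<Sum>P\<in>S \<union> J. f P x *\<^sub>R \<alpha> P)"
        using sSJ by (intro sum.cong) (auto simp: f_def)
      finally show "\<Phi> x = (\<Sum>P\<in>insert s S \<union> J. f P x *\<^sub>R \<alpha> P)"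
        using sSJ fin by (simp add: f_def)
    qed
  qed
qed

lemma weight_decomposition:
  fixes \<Phi> :: "'a \<Rightarrow> 'b::euclidean_space" and \<alpha> :: "('a \<Rightarrow> 'a) \<Rightarrow> 'b"
  assumes "smooth_on V \<Phi>"
    and "\<And>g x. g \<in> \<G> \<Longrightarrow> x \<in> V \<Longrightarrow> \<Phi> (g x) = \<Phi> x"
    and "\<And>x. x \<in> V \<Longrightarrow> \<Phi> x \<in> span (\<alpha> ` {P \<in> \<P>. P x \<noteq> 0})"
  shows "\<exists>f. weight_coefficients \<P> \<alpha> \<Phi> f"
  using partial_weight_decomposition[of \<P> "{}" \<Phi> \<alpha>] assms by simp

section \<open>One-forms from segment averages\<close>

text \<open>
  The integral in Hadamard's formula with the direction $P x$ freed to an arbitrary vector.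
\<close>

definition segment_form :: "('a \<Rightarrow> real) \<Rightarrow> ('a \<Rightarrow> 'a) \<Rightarrow> 'a \<Rightarrow> 'a \<Rightarrow> real" where
  "segment_form f P x v = integral {0..1} (\<lambda>s. frechet_derivative f (at (x - s *\<^sub>R P x)) v)"

lemma segment_form_smooth:
  assumes "P \<in> \<P>" "smooth_on V f"
  shows "smooth_on V (\<lambda>x. segment_form f P x v)"
  unfolding segment_form_def
  by (rule smooth_on_segment_average[OF V(1) linear segment smooth_on_frechet_derivative])
     (use assms in auto)

lemma segment_form_linear:
  assumes "P \<in> \<P>" "smooth_on V f" "x \<in> V"
  shows "linear (segment_form f P x)"
proof -
  have int: "(\<lambda>s. frechet_derivative f (at (x - s *\<^sub>R P x)) v) integrable_on {0..1}" for v
  proof (rule integrable_continuous_real)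
    have path: "continuous_on {0..1} (\<lambda>s. x - s *\<^sub>R P x)" by (intro continuous_intros)
    have "continuous_on V (\<lambda>y. frechet_derivative f (at y) v)"
      using assms(2) by (intro smooth_on_continuous_on smooth_on_frechet_derivative)
    then show "continuous_on {0..1} (\<lambda>s. frechet_derivative f (at (x - s *\<^sub>R P x)) v)"
      by (rule continuous_on_compose2[OF _ path]) (rule image_subsetI, rule segment[OF assms(1,3)])
  qed
  have lin: "Real_Vector_Spaces.linear (frechet_derivative f (at (x - s *\<^sub>R P x)))" if "s \<in> {0..1}" for s
    using smooth_on_has_derivative[OF assms(2) segment[OF assms(1,3) that]] has_derivative_linear by blast
  show ?thesis
  proof (rule linearI)
    show "segment_form f P x (v + w) = segment_form f P x v + segment_form f P x w" for v w
      unfolding segment_form_def integral_add[OF int int, symmetric]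
      by (intro integral_cong) (rule linear_add[OF lin])
    show "segment_form f P x (c *\<^sub>R v) = c *\<^sub>R segment_form f P x v" for c v
      unfolding segment_form_def integral_cmul[symmetric]
      by (intro integral_cong) (rule linear_scale[OF lin])
  qed
qed

lemma frechet_derivative_invariant:
  assumes "smooth_on V f" "g \<in> \<G>" "\<And>x. x \<in> V \<Longrightarrow> f (g x) = f x" "y \<in> V"
  shows "frechet_derivative f (at (g y)) (g v) = frechet_derivative f (at y) v"
proof -
  have "(g has_derivative g) (at y)"
    using linear_group[OF assms(2)] by (simp add: linear_conv_bounded_linear bounded_linear_imp_has_derivative)
  from has_derivative_compose[OF this smooth_on_has_derivative[OF assms(1) V(2)[OF assms(2,4)]]]
  have "((\<lambda>x. f (g x)) has_derivative (\<lambda>v. frechet_derivative f (at (g y)) (g v))) (at y)" .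
  then have "(f has_derivative (\<lambda>v. frechet_derivative f (at (g y)) (g v))) (at y)"
    by (rule has_derivative_transform_within_open[OF _ V(1) assms(4)]) (rule assms(3))
  from frechet_derivative_at[OF this] show ?thesis by metis
qed

lemma segment_form_invariant:
  assumes "P \<in> \<P>" "smooth_on V f" "g \<in> \<G>" "\<And>x. x \<in> V \<Longrightarrow> f (g x) = f x" "x \<in> V"
  shows "segment_form f P (g x) (g v) = segment_form f P x v"
  unfolding segment_form_def
proof (rule integral_cong)
  fix s :: real assume s: "s \<in> {0..1}"
  have "g x - s *\<^sub>R P (g x) = g (x - s *\<^sub>R P x)"
    using linear_group[OF assms(3)] equivariant[OF assms(1,3)] by (simp add: linear_diff linear_scale)
  then show "frechet_derivative f (at (g x - s *\<^sub>R P (g x))) (g v) = frechet_derivative f (at (x - s *\<^sub>R P x)) v"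
    using frechet_derivative_invariant[OF assms(2-4) segment[OF assms(1,5) s]] by simp
qed

text \<open>
  The endpoint $x - Px$ of the segment has vanishing component along \<open>P\<close>, so only the value at $x$
  remains in Hadamard's formula.
\<close>

lemma segment_form_radial:
  assumes "P \<in> \<P>" "smooth_on V f" "x \<in> V" "\<And>x. x \<in> V \<Longrightarrow> P x = 0 \<Longrightarrow> f x = 0"
  shows "segment_form f P x (P x) = f x"
proof -
  have "segment_form f P x (P x) = f x - f (x - P x)"
    unfolding segment_form_def
    by (rule segment_average_derivative[OF linear[OF assms(1)] segment[OF assms(1,3)] assms(2)])
  also have "f (x - P x) = 0"
    using assms(1,3) by (intro assms(4) project_out) (simp_all add: linear_diff linear idem)
  finally show ?thesis by simp
qed

end

section \<open>Abstract moment maps near a fixed point\<close>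

lemma one_parameter_subgroup:
  fixes \<xi> :: "real ^ 'k::finite"
  shows "subgroup (range (\<lambda>t. torus_exp (t *\<^sub>R \<xi>))) torus"
proof -
  interpret comm_group "torus :: (complex ^ 'k) monoid" by (rule comm_group_torus)
  have inv: "inv\<^bsub>torus\<^esub> (torus_exp (t *\<^sub>R \<xi>)) = torus_exp ((- t) *\<^sub>R \<xi>)" for t
    by (rule inv_equality) (simp_all add: torus_exp_closed torus_exp_add[symmetric] torus_exp_0)
  show ?thesis
  proof (rule subgroupI)
    show "inv\<^bsub>torus\<^esub> a \<in> range (\<lambda>t. torus_exp (t *\<^sub>R \<xi>))"
      if a: "a \<in> range (\<lambda>t. torus_exp (t *\<^sub>R \<xi>))" for a
    proof -
      obtain t where "a = torus_exp (t *\<^sub>R \<xi>)" using a by blast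
      then show ?thesis by (intro image_eqI[of _ _ "- t"]) (simp_all only: inv UNIV_I)
    qed
    show "a \<otimes>\<^bsub>torus\<^esub> b \<in> range (\<lambda>t. torus_exp (t *\<^sub>R \<xi>))"
      if "a \<in> range (\<lambda>t. torus_exp (t *\<^sub>R \<xi>))" "b \<in> range (\<lambda>t. torus_exp (t *\<^sub>R \<xi>))" for a b
      using that by (auto simp: torus_exp_add[symmetric] scaleR_add_left[symmetric])
  qed (auto simp: torus_exp_closed)
qed

context torus_rep
begin

text \<open>
  The one-parameter group of \<open>\<xi>\<close> is a subgroup, not necessarily closed, whose Lie algebra contains
  \<open>\<xi>\<close> and which fixes the whole segment from $0$ to $x$. The segment is connected, so the pairing with
  \<open>\<xi>\<close> has the same value at $x$ as at $0$.
\<close>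

lemma moment_map_vanishes_on_stabilizer:
  assumes "abstract_moment_map \<phi> U \<Psi>" "\<Psi> 0 = 0" "gen \<xi> x = 0"
    and seg: "\<And>t. t \<in> {0..1} \<Longrightarrow> t *\<^sub>R x \<in> U"
  shows "\<Psi> x \<xi> = 0"
proof -
  define H where "H = range (\<lambda>t. torus_exp (t *\<^sub>R \<xi>))"
  define F where "F = fixed_points \<phi> H U"
  define r where "r y = restrict (blinfun_apply (\<Psi> y)) (lie_subalgebra H)" for y
  define A where "A = (\<lambda>t. t *\<^sub>R x) ` {0..1}"
  have "\<xi> \<in> lie_subalgebra H" by (auto simp: lie_subalgebra_def H_def)
  have lc: "locally_constant_on r F"
    using assms(1) one_parameter_subgroup[of \<xi>] unfolding abstract_moment_map_def r_def F_def H_def by blast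
  have "A \<subseteq> F"
  proof
    fix y assume "y \<in> A"
    then obtain t where t: "t \<in> {0..1}" "y = t *\<^sub>R x" by (auto simp: A_def)
    have "gen \<xi> y = 0" using assms(3) t by (simp add: blinfun.bilinear_simps)
    then show "y \<in> F"
      using seg[OF t(1)] t flow_fixes_kernel by (auto simp: F_def fixed_points_def H_def flow[symmetric])
  qed
  have "r 0 = r x"
  proof (rule connected_local_const)
    show "connected A"
      unfolding A_def by (intro connected_continuous_image continuous_intros) auto
    show "0 \<in> A" "x \<in> A"
      unfolding A_def by (auto intro: image_eqI[of _ _ 0] image_eqI[of _ _ 1])
    show "\<forall>a\<in>A. \<forall>\<^sub>F b in at a within A. r a = r b"
    proof
      fix a assume "a \<in> A"
      then obtain W where W: "openin (top_of_set F) W" "a \<in> W" "r constant_on W"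
        using lc \<open>A \<subseteq> F\<close> unfolding locally_constant_on_def by blast
      then obtain T where T: "open T" "W = F \<inter> T" by (auto simp: openin_open)
      show "\<forall>\<^sub>F b in at a within A. r a = r b"
        unfolding eventually_at_topological
        using W(2,3) T \<open>A \<subseteq> F\<close> unfolding constant_on_def by (intro exI[of _ T]) auto
    qed
  qed
  then have "r 0 \<xi> = r x \<xi>" by simp
  then show ?thesis using assms(2) \<open>\<xi> \<in> lie_subalgebra H\<close> by (simp add: r_def)
qed

end

section \<open>The invariant one-form\<close>

theorem theorem4p3:
  fixes \<phi> :: "complex ^ 'n::finite \<Rightarrow> real ^ 'm::finite \<Rightarrow> real ^ 'm"
    and U :: "(real ^ 'm) set"
    and \<Psi> :: "real ^ 'm \<Rightarrow> (real ^ 'n) \<Rightarrow>\<^sub>L real"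
  assumes "linear_torus_action \<phi>"
    and "open U" and "0 \<in> U" and "invariant_set \<phi> U"
    and "abstract_moment_map \<phi> U \<Psi>"
    and "\<Psi> 0 = 0"
  shows "\<exists>V \<mu>. open V \<and> 0 \<in> V \<and> V \<subseteq> U \<and> invariant_set \<phi> V \<and> invariant_one_form \<phi> V \<mu> \<and>
           (\<forall>\<xi>. \<forall>x\<in>V. blinfun_apply (\<mu> x) (generated_field \<phi> \<xi> x) = blinfun_apply (\<Psi> x) \<xi>)"
proof -
  interpret torus_rep \<phi> by (unfold_locales) (rule assms(1))
  obtain q where q: "inner_form q" and skew: "\<And>\<xi> x y. q (gen \<xi> x) y = - q x (gen \<xi> y)"
    using invariant_inner_form by metis
  note bil = inner_formD(1)[OF q]
  interpret fam: linear_commuting_skew_family q "\<lambda>\<xi>. blinfun_apply (gen \<xi>)"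
  proof (intro linear_commuting_skew_family.intro commuting_skew_family.intro
      linear_commuting_skew_family_axioms.intro)
    show "linear (blinfun_apply (gen \<xi>))" for \<xi>
      by (rule bounded_linear.linear[OF blinfun.bounded_linear_right])
    show "gen \<xi> (gen \<eta> x) = gen \<eta> (gen \<xi> x)" for \<xi> \<eta> x
      using gen_commute[of \<xi> \<eta>] by (metis blinfun_apply_blinfun_compose)
  qed (fact q skew linear_gen)+
  obtain \<P> \<alpha> J where ws: "fam.weight_system \<P> \<alpha> J"
    using fam.isotypic_decomposition by blast
  note fin = fam.weight_systemD(1)[OF ws] and linP = fam.weight_systemD(2)[OF ws]
    and idem = fam.weight_systemD(3)[OF ws] and orth = fam.weight_systemD(4)[OF ws]
    and sumP = fam.weight_systemD(5)[OF ws] and commP = fam.weight_systemD(6)[OF ws]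
    and linJ = fam.weight_systemD(7)[OF ws] and weight = fam.weight_systemD(8)[OF ws]
    and PJ = fam.weight_systemD(9)[OF ws] and JJ = fam.weight_systemD(10)[OF ws]
    and commJ = fam.weight_systemD(11)[OF ws]
  obtain c where c: "c > 0" "\<And>x. c * (norm x)\<^sup>2 \<le> q x x" using inner_form_coercive[OF q] by blast
  obtain r where r: "r > 0" "ball 0 r \<subseteq> U" using assms(2,3) open_contains_ball by blast
  \<comment> \<open>With this bound on each of the \<open>card \<P>\<close> components the sum of the components stays in the ball of radius \<open>r\<close>.\<close>
  define \<delta> where "\<delta> = r / (real (card \<P>) + 1)"
  have \<delta>: "\<delta> > 0" using r by (simp add: \<delta>_def)
  define V where "V = {x. \<forall>P\<in>\<P>. q (P x) (P x) < c * \<delta>\<^sup>2}"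
  have "open V"
  proof -
    have "open {x. q (P x) (P x) < c * \<delta>\<^sup>2}" if "P \<in> \<P>" for P
    proof (rule open_Collect_less)
      have "continuous_on UNIV P" using linP[OF that] by (simp add: linear_continuous_on linear_conv_bounded_linear)
      then show "continuous_on UNIV (\<lambda>x. q (P x) (P x))" by (intro inner_form_continuous[OF q])
    qed (rule continuous_on_const)
    then have "open (\<Inter>P\<in>\<P>. {x. q (P x) (P x) < c * \<delta>\<^sup>2})" using fin by (intro open_INT) auto
    moreover have "V = (\<Inter>P\<in>\<P>. {x. q (P x) (P x) < c * \<delta>\<^sup>2})" by (auto simp: V_def)
    ultimately show ?thesis by simp
  qed
  have zeroV: "0 \<in> V"
    using c(1) \<delta> linP by (auto simp: V_def linear_0 bilinear_lzero[OF bil])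
  have VU: "V \<subseteq> U"
  proof
    fix x assume x: "x \<in> V"
    have "norm (P x) \<le> \<delta>" if P: "P \<in> \<P>" for P
    proof -
      have "c * (norm (P x))\<^sup>2 < c * \<delta>\<^sup>2"
        using c(2)[of "P x"] x P by (force simp: V_def)
      then have "(norm (P x))\<^sup>2 < \<delta>\<^sup>2" using c(1) by simp
      then show ?thesis using \<delta> by (meson less_imp_le power2_less_imp_less)
    qed
    then have "norm x \<le> real (card \<P>) * \<delta>"
      using sum_norm_le[of \<P> "\<lambda>P. P x" "\<lambda>_. \<delta>"] by (simp add: sumP)
    also have "\<dots> < r" using r(1) by (simp add: \<delta>_def field_simps)
    finally show "x \<in> U" using r(2) by auto
  qed
  have actV: "\<phi> g x \<in> V" if "g \<in> carrier torus" "x \<in> V" for g x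
    using that inner_form_action_invariant[OF q skew that(1)]
    by (simp add: V_def commP[OF _ action_in_commutant[OF that(1)], symmetric])
  interpret pf: projection_family \<P> "\<phi> ` carrier torus" V
  proof (rule projection_family.intro)
    show "g (P x) = P (g x)" if "P \<in> \<P>" "g \<in> \<phi> ` carrier torus" for P g x
      using that commP action_in_commutant by blast
    show "x - s *\<^sub>R P x \<in> V" if P: "P \<in> \<P>" and x: "x \<in> V" and s: "s \<in> {0..1}" for P x s
      unfolding V_def mem_Collect_eq
    proof
      fix Q assume Q: "Q \<in> \<P>"
      show "q (Q (x - s *\<^sub>R P x)) (Q (x - s *\<^sub>R P x)) < c * \<delta>\<^sup>2"
      proof (cases "Q = P")
        case True
        have "Q (x - s *\<^sub>R P x) = (1 - s) *\<^sub>R Q x"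
          using True P by (simp add: linear_diff linear_scale linP idem algebra_simps)
        then have "q (Q (x - s *\<^sub>R P x)) (Q (x - s *\<^sub>R P x)) = (1 - s)\<^sup>2 * q (Q x) (Q x)"
          by (simp add: bilinear_lmul[OF bil] bilinear_rmul[OF bil] power2_eq_square)
        also have "\<dots> \<le> 1 * q (Q x) (Q x)"
          using s by (intro mult_right_mono inner_form_nonneg[OF q]) (auto intro: power_le_one)
        finally show ?thesis using x Q by (force simp: V_def)
      next
        case False
        then have "Q (x - s *\<^sub>R P x) = Q x"
          using P Q by (simp add: linear_diff linear_scale linP orth)
        then show ?thesis using x Q by (simp add: V_def)
      qed
    qed
  qed (use fin linP idem orth \<open>open V\<close> actV linear in auto)

  \<comment> \<open>The moment map as a vector: the functional \<open>\<Psi> x\<close> is the inner product with \<open>\<psi> x\<close>.\<close>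
  define \<psi> where "\<psi> x = (\<Sum>b\<in>Basis. blinfun_apply (\<Psi> x) b *\<^sub>R b)" for x
  have \<psi>: "\<xi> \<bullet> \<psi> x = \<Psi> x \<xi>" for \<xi> x
  proof -
    have "\<Psi> x \<xi> = \<Psi> x (\<Sum>b\<in>Basis. (\<xi> \<bullet> b) *\<^sub>R b)" by (simp add: euclidean_representation)
    also have "\<dots> = (\<Sum>b\<in>Basis. (\<xi> \<bullet> b) * \<Psi> x b)" by (simp add: blinfun.bilinear_simps)
    finally show ?thesis by (simp add: \<psi>_def inner_sum_right mult.commute)
  qed
  have "\<exists>f. pf.weight_coefficients \<P> \<alpha> \<psi> f"
  proof (rule pf.weight_decomposition)
    have grad: "bounded_linear (\<lambda>L :: (real ^ 'n) \<Rightarrow>\<^sub>L real. \<Sum>b\<in>Basis. blinfun_apply L b *\<^sub>R b)"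
      by (intro bounded_linear_sum bounded_linear_scaleR_const blinfun.bounded_linear_left)
    have "smooth_on V \<Psi>"
      using assms(5) VU smooth_on_subset by (auto simp: abstract_moment_map_def)
    from smooth_on_bounded_linear[OF \<open>open V\<close> this grad]
    show "smooth_on V \<psi>" unfolding \<psi>_def[abs_def] .
    show "\<psi> (g x) = \<psi> x" if gx: "g \<in> \<phi> ` carrier torus" "x \<in> V" for g x
    proof -
      obtain h where h: "h \<in> carrier torus" "g = \<phi> h" using gx(1) by blast
      moreover have "x \<in> U" using that(2) VU by blast
      ultimately have "\<Psi> (g x) = \<Psi> x" using assms(5) unfolding abstract_moment_map_def by blast
      then show ?thesis by (simp add: \<psi>_def)
    qed
    show "\<psi> x \<in> span (\<alpha> ` {P \<in> \<P>. P x \<noteq> 0})" if x: "x \<in> V" for x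
    proof (rule in_span_if_orthogonal)
      fix \<xi> assume \<xi>: "\<And>a. a \<in> \<alpha> ` {P \<in> \<P>. P x \<noteq> 0} \<Longrightarrow> \<xi> \<bullet> a = 0"
      have "gen \<xi> (P x) = 0" if "P \<in> \<P>" for P
        using \<xi> that weight[OF that, of \<xi> x] by (cases "P x = 0") auto
      then have "gen \<xi> (\<Sum>P\<in>\<P>. P x) = 0" by (simp add: blinfun.sum_right)
      then have "gen \<xi> x = 0" by (simp add: sumP)
      moreover have "t *\<^sub>R x \<in> U" if t: "t \<in> {0..1}" for t
      proof -
        have "q (P (t *\<^sub>R x)) (P (t *\<^sub>R x)) < c * \<delta>\<^sup>2" if P: "P \<in> \<P>" for P
        proof -
          have "q (P (t *\<^sub>R x)) (P (t *\<^sub>R x)) = t\<^sup>2 * q (P x) (P x)"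
            using linP[OF P] by (simp add: linear_scale bilinear_lmul[OF bil] bilinear_rmul[OF bil] power2_eq_square)
          also have "\<dots> \<le> 1 * q (P x) (P x)"
            using t by (intro mult_right_mono inner_form_nonneg[OF q]) (auto intro: power_le_one)
          finally show ?thesis using x P by (force simp: V_def)
        qed
        then show ?thesis using VU by (auto simp: V_def)
      qed
      ultimately show "\<xi> \<bullet> \<psi> x = 0"
        unfolding \<psi> by (rule moment_map_vanishes_on_stabilizer[OF assms(5,6)])
    qed
  qed
  then obtain f where "pf.weight_coefficients \<P> \<alpha> \<psi> f" ..
  note f = pf.weight_coefficientsD[OF this]

  \<comment> \<open>Contracting with \<open>J P x\<close> replaces \<open>J P v\<close> by \<open>- P x\<close>, which explains the sign.\<close>
  define m where "m x v = - (\<Sum>P\<in>\<P>. pf.segment_form (f P) P x (J P v))" for x v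
  define \<mu> where "\<mu> x = (\<Sum>b\<in>Basis. m x b *\<^sub>R blinfun_inner_left b)" for x
  have \<mu>: "\<mu> x v = m x v" if x: "x \<in> V" for x v
  proof -
    have "linear (m x)"
    proof -
      have "linear (\<lambda>v. pf.segment_form (f P) P x (J P v))" if "P \<in> \<P>" for P
        using linear_compose[OF linJ[OF that] pf.segment_form_linear[OF that f(1)[OF that] x]] by (simp add: o_def)
      then show ?thesis
        unfolding m_def[abs_def] by (intro linear_compose_neg linear_compose_sum) auto
    qed
    then have "m x v = (\<Sum>b\<in>Basis. (v \<bullet> b) * m x b)"
      by (subst euclidean_representation[of v, symmetric]) (simp add: linear_sum linear_scale)
    then show ?thesis
      by (simp add: \<mu>_def blinfun.sum_left blinfun.scaleR_left inner_commute mult.commute)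
  qed
  have smooth: "smooth_on V \<mu>"
    unfolding \<mu>_def[abs_def]
  proof (rule smooth_on_sum[OF \<open>open V\<close>])
    fix b :: "real ^ 'm"
    have "smooth_on V (\<lambda>x. \<Sum>P\<in>\<P>. pf.segment_form (f P) P x (J P b))"
      by (intro smooth_on_sum[OF \<open>open V\<close>] pf.segment_form_smooth f(1))
    then have "smooth_on V (\<lambda>x. m x b)"
      unfolding m_def by (rule smooth_on_bounded_linear[OF \<open>open V\<close> _ bounded_linear_minus[OF bounded_linear_ident]])
    then show "smooth_on V (\<lambda>x. m x b *\<^sub>R blinfun_inner_left b)"
      by (rule smooth_on_bounded_linear[OF \<open>open V\<close> _ bounded_linear_scaleR_left])
  qed
  have inv: "\<mu> (\<phi> g x) (\<phi> g v) = \<mu> x v" if g: "g \<in> carrier torus" and x: "x \<in> V" for g x v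
  proof -
    have "pf.segment_form (f P) P (\<phi> g x) (J P (\<phi> g v)) = pf.segment_form (f P) P x (J P v)" if P: "P \<in> \<P>" for P
    proof -
      have "pf.segment_form (f P) P (\<phi> g x) (\<phi> g (J P v)) = pf.segment_form (f P) P x (J P v)"
        using g by (intro pf.segment_form_invariant[OF P f(1)[OF P] _ _ x] f(2)[OF P]) auto
      then show ?thesis by (simp add: commJ[OF P action_in_commutant[OF g]])
    qed
    then show ?thesis by (simp add: \<mu> x actV[OF g x] m_def)
  qed
  have contract: "\<mu> x (gen \<xi> x) = \<Psi> x \<xi>" if x: "x \<in> V" for \<xi> x
  proof -
    have "pf.segment_form (f P) P x (J P (gen \<xi> x)) = - ((\<xi> \<bullet> \<alpha> P) * f P x)" if P: "P \<in> \<P>" for P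
    proof -
      \<comment> \<open>Generators respect the components, so \<open>J P\<close> sees only the component of the field along \<open>P\<close>.\<close>
      have "J P (gen \<xi> x) = gen \<xi> (P (J P x))"
        using commJ[OF P fam.in_commutant] by (simp add: PJ[OF P])
      also have "\<dots> = (\<xi> \<bullet> \<alpha> P) *\<^sub>R J P (J P x)" by (rule weight[OF P])
      also have "\<dots> = (- (\<xi> \<bullet> \<alpha> P)) *\<^sub>R P x" by (cases "\<alpha> P = 0") (simp_all add: JJ[OF P])
      finally show ?thesis
        using pf.segment_form_linear[OF P f(1)[OF P] x] pf.segment_form_radial[OF P f(1)[OF P] x f(3)[OF P]]
        by (simp only: linear_scale) simp
    qed
    then have "m x (gen \<xi> x) = (\<Sum>P\<in>\<P>. (\<xi> \<bullet> \<alpha> P) * f P x)"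
      by (simp add: m_def sum_negf)
    also have "\<dots> = \<xi> \<bullet> (\<Sum>P\<in>\<P>. f P x *\<^sub>R \<alpha> P)" by (simp add: inner_sum_right mult.commute)
    also have "\<dots> = \<Psi> x \<xi>" by (simp add: f(4)[OF x, symmetric] \<psi>)
    finally show ?thesis by (simp add: \<mu>[OF x])
  qed
  show ?thesis
    using \<open>open V\<close> zeroV VU actV smooth inv contract
    by (intro exI[of _ V] exI[of _ \<mu>])
       (auto simp: invariant_set_def invariant_one_form_def generated_field_eq)
qed

end
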